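(* Let $A$ be a Banach algebra with a bounded approximate identity and let $B$ be a Banach $A$-bimodule. (1) If either $B^*$ factors on the left with respect to $A$ and $A$ has the $Rw^*w$-property, or $B^*$ factors on the right with respect to $A$ and $A$ has the $Lw^*w$-property, then $Z_{B^{**}}(A^{**})=A^{**}$. (2) If either $B^*$ factors on the left with respect to $A$ and $A$ has the $Rw^*w$-property with respect to $B$, or $B^*$ factors on the right with respect to $A$ and $A$ has the $Lw^*w$-property with respect to $B$, then $Z_{A^{**}}(B^{**})=B^{**}$.
   Context: $\pi_\ell:A\times B\to B$, $\pi_\ell(a,b)=ab$ and $\pi_r:B\times A\to B$, $\pi_r(b,a)=ba$ are the module actions. $B^*$ is an $A$-bimodule via $\langle b'a,b\rangle=\langle b',ab\rangle$, $\langle ab',b\rangle=\langle b',ba\rangle$ (likewise $A^*$). $B^*$ factors on the left (resp. right) with respect to $A$ if $B^*=B^*A:=\{b'a:b'\in B^*,a\in A\}$ (resp. $B^*=AB^*:=\{ab':a\in A,b'\in B^*\}$). An element $a\in A$ has the $Lw^*w$-property with respect to $B$ if for every net $(b'_\alpha)\subseteq B^*$, $ab'_\alpha\to0$ weak$^*$ implies $ab'_\alpha\to0$ weakly; it has the $Rw^*w$-property with respect to $B$ if for every net $(b'_\alpha)\subseteq B^*$, $b'_\alpha a\to0$ weak$^*$ implies $b'_\alpha a\to0$ weakly. $A$ has the $Lw^*w$- (resp. $Rw^*w$-) property with respect to $B$ if every $a\in A$ does. If no module is mentioned, the property is with respect to $B=A$. For a bounded bilinear $m:X\times Y\to Z$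 of normed spaces: $\langle m^*(z',x),y\rangle=\langle z',m(x,y)\rangle$, $\langle m^{**}(y'',z'),x\rangle=\langle y'',m^*(z',x)\rangle$, $\langle m^{***}(x'',y''),z'\rangle=\langle x'',m^{**}(y'',z')\rangle$. $Z_{B^{**}}(A^{**})=\{a''\in A^{**}: b''\mapsto\pi_\ell^{***}(a'',b''),\ B^{**}\to B^{**},\text{ is weak}^*\text{-to-weak}^*\text{ continuous}\}$; $Z_{A^{**}}(B^{**})=\{b''\in B^{**}: a''\mapsto\pi_r^{***}(b'',a''),\ A^{**}\to B^{**},\text{ is weak}^*\text{-to-weak}^*\text{ continuous}\}$. *)

theory Defs
  imports "HOL-Analysis.Analysis"
begin

text \<open>
  Everything is parametric in the scalar field \<open>'k\<close>, of class \<open>real_normed_field\<close> and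
  \<open>heine_borel\<close>; both \<open>real\<close> and \<open>complex\<close> are instances. A normed space over \<open>'k\<close> is a type
  of class \<open>real_normed_vector\<close> with a compatible scalar multiplication by \<open>'k\<close>.
\<close>

locale normed_space_over = vector_space scl
  for scl :: "'k::real_normed_field \<Rightarrow> 'v::real_normed_vector \<Rightarrow> 'v" +
  assumes norm_scale: "norm (scl c x) = norm c * norm x"
    and scale_of_real: "scl (of_real r) x = r *\<^sub>R x"

locale bounded_bilinear_over =
  X: normed_space_over scaleX + Y: normed_space_over scaleY + Z: normed_space_over scaleZ +
  bounded_bilinear m
  for scaleX :: "'k::real_normed_field \<Rightarrow> 'x::real_normed_vector \<Rightarrow> 'x"
    and scaleY :: "'k \<Rightarrow> 'y::real_normed_vector \<Rightarrow> 'y"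
    and scaleZ :: "'k \<Rightarrow> 'z::real_normed_vector \<Rightarrow> 'z"
    and m :: "'x \<Rightarrow> 'y \<Rightarrow> 'z" +
  assumes scale_left: "m (scaleX c x) y = scaleZ c (m x y)"
    and scale_right: "m x (scaleY c y) = scaleZ c (m x y)"

locale banach_algebra_over = bounded_bilinear_over scl scl scl "(*)"
  for scl :: "'k::real_normed_field \<Rightarrow> 'a::{real_normed_algebra,banach} \<Rightarrow> 'a"

locale banach_bimodule_over =
  alg: banach_algebra_over scaleA +
  left: bounded_bilinear_over scaleA scaleB scaleB lact +
  right: bounded_bilinear_over scaleB scaleA scaleB ract
  for scaleA :: "'k::real_normed_field \<Rightarrow> 'a::{real_normed_algebra,banach} \<Rightarrow> 'a"
    and scaleB :: "'k \<Rightarrow> 'b::banach \<Rightarrow> 'b"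
    and lact :: "'a \<Rightarrow> 'b \<Rightarrow> 'b"
    and ract :: "'b \<Rightarrow> 'a \<Rightarrow> 'b" +
  assumes lact_mult: "lact (a * a') b = lact a (lact a' b)"
    and ract_mult: "ract b (a * a') = ract (ract b a) a'"
    and lact_ract: "ract (lact a b) a' = lact a (ract b a')"

text \<open>Nets are represented by filters: a net corresponds to the filter generated by its tails.\<close>

definition bounded_approximate_identity :: "'a::real_normed_algebra filter \<Rightarrow> bool" where
  "bounded_approximate_identity E \<longleftrightarrow> E \<noteq> bot \<and> (\<exists>M. \<forall>\<^sub>F e in E. norm e \<le> M) \<and>
     (\<forall>a. ((\<lambda>e. e * a) \<longlongrightarrow> a) E \<and> ((\<lambda>e. a * e) \<longlongrightarrow> a) E)"

text \<open>The topological dual \<open>V\<^sup>*\<close>, its operator norm being \<^const>\<open>onorm\<close>, and the bidual \<open>V\<^sup>*\<^sup>*\<close>.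
  A functional on \<open>V\<^sup>*\<close> only has meaningful values on \<open>V\<^sup>*\<close>, whence \<^const>\<open>extensional\<close>.\<close>

definition top_dual :: "('k::real_normed_field \<Rightarrow> 'v::real_normed_vector \<Rightarrow> 'v) \<Rightarrow> ('v \<Rightarrow> 'k) set" where
  "top_dual scl = {f. bounded_linear f \<and> (\<forall>c x. f (scl c x) = c * f x)}"

definition top_bidual ::
  "('k::real_normed_field \<Rightarrow> 'v::real_normed_vector \<Rightarrow> 'v) \<Rightarrow> (('v \<Rightarrow> 'k) \<Rightarrow> 'k) set" where
  "top_bidual scl = {F \<in> extensional (top_dual scl).
     (\<forall>f\<in>top_dual scl. \<forall>g\<in>top_dual scl. F (\<lambda>x. f x + g x) = F f + F g) \<and>
     (\<forall>c. \<forall>f\<in>top_dual scl. F (\<lambda>x. c * f x) = c * F f) \<and>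
     (\<exists>C. \<forall>f\<in>top_dual scl. norm (F f) \<le> C * onorm f)}"

text \<open>The weak* topologies are the topologies of pointwise convergence on \<open>V\<close> and on \<open>V\<^sup>*\<close>.\<close>

definition weak_star_dual ::
  "('k::real_normed_field \<Rightarrow> 'v::real_normed_vector \<Rightarrow> 'v) \<Rightarrow> ('v \<Rightarrow> 'k) topology" where
  "weak_star_dual scl = subtopology (product_topology (\<lambda>_. euclidean) UNIV) (top_dual scl)"

definition weak_star_bidual ::
  "('k::real_normed_field \<Rightarrow> 'v::real_normed_vector \<Rightarrow> 'v) \<Rightarrow> (('v \<Rightarrow> 'k) \<Rightarrow> 'k) topology" where
  "weak_star_bidual scl =
     subtopology (product_topology (\<lambda>_. euclidean) (top_dual scl)) (top_bidual scl)"

text \<open>The weak topology of \<open>V\<^sup>*\<close>: the initial topology for the elements of \<open>V\<^sup>*\<^sup>*\<close>.\<close>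

definition weak_dual ::
  "('k::real_normed_field \<Rightarrow> 'v::real_normed_vector \<Rightarrow> 'v) \<Rightarrow> ('v \<Rightarrow> 'k) topology" where
  "weak_dual scl = pullback_topology (top_dual scl) (\<lambda>f. \<lambda>F\<in>top_bidual scl. F f)
     (product_topology (\<lambda>_. euclidean) (top_bidual scl))"

text \<open>The module actions on \<open>B\<^sup>*\<close>: \<open>a b'\<close> is \<open>b \<mapsto> b' (b a)\<close> and \<open>b' a\<close> is \<open>b \<mapsto> b' (a b)\<close>.\<close>

definition dual_lact :: "('b \<Rightarrow> 'a \<Rightarrow> 'b) \<Rightarrow> 'a \<Rightarrow> ('b \<Rightarrow> 'k) \<Rightarrow> 'b \<Rightarrow> 'k" where
  "dual_lact ract a b' = (\<lambda>b. b' (ract b a))"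

definition dual_ract :: "('a \<Rightarrow> 'b \<Rightarrow> 'b) \<Rightarrow> ('b \<Rightarrow> 'k) \<Rightarrow> 'a \<Rightarrow> 'b \<Rightarrow> 'k" where
  "dual_ract lact b' a = (\<lambda>b. b' (lact a b))"

definition dual_factors_left ::
  "('k::real_normed_field \<Rightarrow> 'b::real_normed_vector \<Rightarrow> 'b) \<Rightarrow> ('a \<Rightarrow> 'b \<Rightarrow> 'b) \<Rightarrow> bool" where
  "dual_factors_left scaleB lact \<longleftrightarrow>
     top_dual scaleB = {dual_ract lact b' a | b' a. b' \<in> top_dual scaleB}"

definition dual_factors_right ::
  "('k::real_normed_field \<Rightarrow> 'b::real_normed_vector \<Rightarrow> 'b) \<Rightarrow> ('b \<Rightarrow> 'a \<Rightarrow> 'b) \<Rightarrow> bool" where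
  "dual_factors_right scaleB ract \<longleftrightarrow>
     top_dual scaleB = {dual_lact ract a b' | a b'. b' \<in> top_dual scaleB}"

text \<open>In both properties \<open>N\<close> ranges over the (not necessarily bounded) nets in \<open>B\<^sup>*\<close>.\<close>

definition Lww_property ::
  "('k::real_normed_field \<Rightarrow> 'b::real_normed_vector \<Rightarrow> 'b) \<Rightarrow> ('b \<Rightarrow> 'a \<Rightarrow> 'b) \<Rightarrow> bool" where
  "Lww_property scaleB ract \<longleftrightarrow> (\<forall>a. \<forall>N. (\<forall>\<^sub>F b' in N. b' \<in> top_dual scaleB) \<longrightarrow>
     limitin (weak_star_dual scaleB) (\<lambda>b'. dual_lact ract a b') (\<lambda>_. 0) N \<longrightarrow>
     limitin (weak_dual scaleB) (\<lambda>b'. dual_lact ract a b') (\<lambda>_. 0) N)"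

definition Rww_property ::
  "('k::real_normed_field \<Rightarrow> 'b::real_normed_vector \<Rightarrow> 'b) \<Rightarrow> ('a \<Rightarrow> 'b \<Rightarrow> 'b) \<Rightarrow> bool" where
  "Rww_property scaleB lact \<longleftrightarrow> (\<forall>a. \<forall>N. (\<forall>\<^sub>F b' in N. b' \<in> top_dual scaleB) \<longrightarrow>
     limitin (weak_star_dual scaleB) (\<lambda>b'. dual_ract lact b' a) (\<lambda>_. 0) N \<longrightarrow>
     limitin (weak_dual scaleB) (\<lambda>b'. dual_ract lact b' a) (\<lambda>_. 0) N)"

text \<open>The Arens adjoints \<open>m\<^sup>*\<close>, \<open>m\<^sup>*\<^sup>*\<close>, \<open>m\<^sup>*\<^sup>*\<^sup>*\<close> of \<open>m : X \<times> Y \<rightarrow> Z\<close>.\<close>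

definition adj1 :: "('x \<Rightarrow> 'y \<Rightarrow> 'z) \<Rightarrow> ('z \<Rightarrow> 'k) \<Rightarrow> 'x \<Rightarrow> 'y \<Rightarrow> 'k" where
  "adj1 m z' x = (\<lambda>y. z' (m x y))"

definition adj2 :: "('x \<Rightarrow> 'y \<Rightarrow> 'z) \<Rightarrow> (('y \<Rightarrow> 'k) \<Rightarrow> 'k) \<Rightarrow> ('z \<Rightarrow> 'k) \<Rightarrow> 'x \<Rightarrow> 'k" where
  "adj2 m y'' z' = (\<lambda>x. y'' (adj1 m z' x))"

definition adj3 ::
  "('k::real_normed_field \<Rightarrow> 'z::real_normed_vector \<Rightarrow> 'z) \<Rightarrow> ('x \<Rightarrow> 'y \<Rightarrow> 'z) \<Rightarrow>
   (('x \<Rightarrow> 'k) \<Rightarrow> 'k) \<Rightarrow> (('y \<Rightarrow> 'k) \<Rightarrow> 'k) \<Rightarrow> (('z \<Rightarrow> 'k) \<Rightarrow> 'k)" where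
  "adj3 scaleZ m x'' y'' = (\<lambda>z'\<in>top_dual scaleZ. x'' (adj2 m y'' z'))"

text \<open>The topological centre of \<open>m : X \<times> Y \<rightarrow> Z\<close> in \<open>X\<^sup>*\<^sup>*\<close>; for \<open>m = \<pi>\<^sub>\<ell>\<close> this is
  \<open>Z\<close> of \<open>A\<^sup>*\<^sup>*\<close> relative to \<open>B\<^sup>*\<^sup>*\<close>, for \<open>m = \<pi>\<^sub>r\<close> it is \<open>Z\<close> of \<open>B\<^sup>*\<^sup>*\<close> relative to \<open>A\<^sup>*\<^sup>*\<close>.\<close>

definition topological_centre ::
  "('k::real_normed_field \<Rightarrow> 'x::real_normed_vector \<Rightarrow> 'x) \<Rightarrow>
   ('k \<Rightarrow> 'y::real_normed_vector \<Rightarrow> 'y) \<Rightarrow> ('k \<Rightarrow> 'z::real_normed_vector \<Rightarrow> 'z) \<Rightarrow>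
   ('x \<Rightarrow> 'y \<Rightarrow> 'z) \<Rightarrow> (('x \<Rightarrow> 'k) \<Rightarrow> 'k) set" where
  "topological_centre scaleX scaleY scaleZ m = {x'' \<in> top_bidual scaleX.
     continuous_map (weak_star_bidual scaleY) (weak_star_bidual scaleZ) (\<lambda>y''. adj3 scaleZ m x'' y'')}"

end

theory Submission
  imports Defs "HOL-Computational_Algebra.Fundamental_Theorem_Algebra"
begin

text \<open>
  The \<open>w\<^sup>*w\<close>-properties quantify over unbounded nets, and therefore say that for all \<open>F\<close> in the
  bidual and \<open>a\<close> in \<open>A\<close> the functional \<open>f \<mapsto> F (a f)\<close> is evaluation at some \<open>b a\<close>. If the dual
  factors on the left, writing \<open>f = h a\<close> turns \<open>F\<close>, in both parts, into an evaluation, and weak*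
  continuity is immediate.

  In the right-hand case of (1), the hypothesis makes \<open>A\<close> unital: otherwise the bounded approximate
  identity contains a sequence \<open>e\<^sub>n\<close> with steps bounded away from zero which is an approximate identity
  for its own members. By Cohen's theorem there is \<open>x\<close> with \<open>x e\<^sub>n = e\<^sub>n\<close> for all \<open>n\<close>, right
  multiplication by \<open>x\<close> is weakly compact, and this makes the steps of \<open>e\<^sub>n\<close> small. For unital \<open>A\<close> the
  property at the unit says that every element of the bidual is an evaluation.

  In the right-hand case of (2), Cohen's theorem for the module \<open>B\<^sup>*\<close> shows that each element of
  \<open>B\<^sup>*\<^sup>*\<close> agrees on any sequence of functionals with an element of \<open>B\<close>. A double limit argument then
  shows that the two extensions of \<open>f (b a)\<close> to the biduals coincide.

  The Hahn-Banach theorem is needed over the abstract field of scalars; a real normed field is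
  \<open>\<real> + \<real> j\<close> with \<open>j = 0\<close> or \<open>j\<^sup>2 = -1\<close>, so the complex version follows from the real one.
\<close>

section \<open>Real normed fields\<close>

lemma poly_map_of_real_add:
  fixes t :: "'k::{real_algebra_1,comm_ring_1}"
  shows "poly (map_poly of_real (p + q)) t = poly (map_poly of_real p) t + poly (map_poly of_real q) t"
  by (subst poly_add[symmetric], rule arg_cong[where f="\<lambda>p. poly p t"])
     (simp add: poly_eq_iff coeff_map_poly)

lemma poly_map_of_real_mult:
  fixes t :: "'k::{real_algebra_1,comm_ring_1}"
  shows "poly (map_poly of_real (p * q)) t = poly (map_poly of_real p) t * poly (map_poly of_real q) t"
proof (induction p)
  case (pCons a p)
  have "poly (map_poly of_real (smult a q)) t = of_real a * poly (map_poly of_real q) t"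
    by (subst poly_smult[symmetric], rule arg_cong[where f="\<lambda>p. poly p t"])
       (simp add: poly_eq_iff coeff_map_poly)
  then show ?case
    using pCons by (simp add: poly_map_of_real_add map_poly_pCons algebra_simps)
qed simp

lemma poly_map_of_real_of_real:
  "poly (map_poly of_real p) (of_real x :: 'k::{real_algebra_1,comm_ring_1}) = of_real (poly p x)"
  by (induction p) (simp_all add: map_poly_pCons)

text \<open>Over the reals a monic polynomial splits into factors \<open>x - a\<close> and
  \<open>(x - a)\<^sup>2 + b\<^sup>2\<close>, and the norm is multiplicative. Taking
  \<open>b = 0\<close> in the assumed bound covers the linear factors.\<close>

lemma norm_monic_real_poly_ge:
  fixes t :: "'k::real_normed_field"
  assumes "0 \<le> \<mu>" and bound: "\<And>a b. \<mu>\<^sup>2 \<le> norm ((t - of_real a)\<^sup>2 + of_real (b\<^sup>2))"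
    and "lead_coeff p = 1"
  shows "\<mu> ^ degree p \<le> norm (poly (map_poly of_real p) t)"
  using \<open>lead_coeff p = 1\<close>
proof (induction "degree p" arbitrary: p rule: less_induct)
  case less
  \<comment> \<open>One factor of positive degree that obeys the bound suffices: the cofactor is
    monic of smaller degree, and degrees add.\<close>
  have step: ?case if "p = q * s" "lead_coeff q = 1" "degree q > 0"
      and "\<mu> ^ degree q \<le> norm (poly (map_poly of_real q) t)" for q s
  proof -
    have s: "lead_coeff s = 1"
      using that less.prems by (simp add: lead_coeff_mult)
    then have deg: "degree p = degree q + degree s"
      using that by (subst that(1), subst degree_mult_eq) auto
    then have "\<mu> ^ degree s \<le> norm (poly (map_poly of_real s) t)"
      using less.hyps[OF _ s] that by simp
    then show ?case
      using that deg \<open>0 \<le> \<mu>\<close>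
      by (simp add: poly_map_of_real_mult norm_mult power_add mult_mono)
  qed
  show ?case
  proof (cases "degree p = 0")
    case True
    then obtain c where "p = [:c:]"
      by (metis degree_eq_zeroE)
    then show ?thesis
      using less.prems by (simp add: map_poly_pCons)
  next
    case False
    have "degree (map_poly complex_of_real p) = degree p"
      by (simp add: degree_map_poly)
    then have "\<not> constant (poly (map_poly complex_of_real p))"
      using False by (simp add: constant_degree)
    then obtain z where z: "poly (map_poly complex_of_real p) z = 0"
      using fundamental_theorem_of_algebra by blast
    show ?thesis
    proof (cases "Im z = 0")
      case True
      then have "z = of_real (Re z)"
        by (simp add: complex_eq_iff)
      then have "complex_of_real (poly p (Re z)) = 0"
        using z by (metis poly_map_of_real_of_real)
      then have "[:- Re z, 1:] dvd p"
        by (simp add: poly_eq_0_iff_dvd)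
      then obtain s where s: "p = [:- Re z, 1:] * s" ..
      have "\<mu>\<^sup>2 \<le> (norm (t - of_real (Re z)))\<^sup>2"
        using bound[of "Re z" 0] by (simp add: norm_power)
      then have "\<mu> \<le> norm (t - of_real (Re z))"
        using power2_le_imp_le norm_ge_zero by blast
      then show ?thesis
        by (intro step[OF s]) (simp_all add: map_poly_pCons)
    next
      case False
      \<comment> \<open>The real quadratic whose roots are \<open>z\<close> and its
        conjugate.\<close>
      define q where "q = [:(Re z)\<^sup>2 + (Im z)\<^sup>2, - 2 * Re z, 1:]"
      have qz: "poly (map_poly complex_of_real q) z = 0"
        by (simp add: q_def map_poly_pCons complex_eq_iff power2_eq_square algebra_simps)
      have "degree (p mod q) < 2"
        using degree_mod_less'[of q p] by (cases "p mod q = 0") (auto simp: q_def)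
      then obtain \<alpha> \<beta> where r: "p mod q = [:\<beta>, \<alpha>:]"
        by (metis degree_eq_zeroE less_2_cases degree_pCons_eq_if One_nat_def pCons_cases
            pCons_0_0 old.nat.inject nat.distinct(1))
      have "poly (map_poly complex_of_real (p div q * q + p mod q)) z = 0"
        using z by simp
      then have "complex_of_real \<beta> + z * of_real \<alpha> = 0"
        unfolding poly_map_of_real_add poly_map_of_real_mult qz r
        by (simp add: map_poly_pCons)
      then have "\<beta> + Re z * \<alpha> = 0" "Im z * \<alpha> = 0"
        by (simp_all add: complex_eq_iff)
      \<comment> \<open>A real polynomial of degree at most one that vanishes at a nonreal point is
        zero.\<close>
      then have "p mod q = 0"
        using False r by simp
      then have s: "p = q * (p div q)"
        by (metis dvd_mult_div_cancel mod_0_imp_dvd)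
      have "\<mu>\<^sup>2 \<le> norm (poly (map_poly of_real q) t)"
        using bound[of "Re z" "Im z"]
        by (simp add: q_def map_poly_pCons power2_eq_square algebra_simps)
      then show ?thesis
        by (intro step[OF s]) (simp_all add: q_def numeral_2_eq_2)
    qed
  qed
qed


text \<open>Put \<open>w = h a b\<close>. Then \<open>w ^ n - (- s) ^ n = (w + s) * R\<close> where
  \<open>R\<close> is a monic real polynomial in \<open>t\<close> of degree
  \<open>2 * (n - 1)\<close>, hence of norm at least \<open>m ^ (n - 1)\<close>. Dividing gives the
  bound \<open>m + m * (s / m) ^ n\<close>, which tends to \<open>m\<close>.\<close>

lemma norm_add_real_le_of_minimal:
  fixes t :: "'k::real_normed_field"
  defines "h \<equiv> \<lambda>a b. (t - of_real a)\<^sup>2 + of_real (b\<^sup>2)"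
  assumes "m > 0" and min: "\<And>a b. m \<le> norm (h a b)"
    and w: "norm (h a b) = m" and s: "0 \<le> s" "s < m"
  shows "norm (h a b + of_real s) \<le> m"
proof -
  define q where "q = [:a\<^sup>2 + b\<^sup>2, - 2 * a, 1:]"
  have ev_q: "poly (map_poly of_real q) t = h a b"
    by (simp add: q_def h_def map_poly_pCons power2_eq_square algebra_simps)
  have "norm (h a b + of_real s) \<le> m + m * (s / m) ^ n" if "n > 0" for n
  proof -
    define R where "R = (\<Sum>i<n. [:-s:] ^ (n - Suc i) * q ^ i)"
    have eq: "q ^ n - [:-s:] ^ n = (q - [:-s:]) * R"
      unfolding R_def by (rule power_diff_sumr2)
    have const: "[:-s:] ^ n = [:(-s) ^ n:]"
      by (simp add: poly_const_pow)
    have q: "degree q = 2" "lead_coeff q = 1"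
      by (simp_all add: q_def)
    then have dqn: "degree (q ^ n) = 2 * n" and lqn: "lead_coeff (q ^ n) = 1"
      using degree_power_eq[of q n] lead_coeff_power[of q n] by fastforce+
    have dl: "degree (q ^ n - [:-s:] ^ n) = 2 * n" "lead_coeff (q ^ n - [:-s:] ^ n) = 1"
    proof -
      show "degree (q ^ n - [:-s:] ^ n) = 2 * n"
        unfolding const diff_conv_add_uminus
        by (subst degree_add_eq_left) (use dqn that in auto)
      then show "lead_coeff (q ^ n - [:-s:] ^ n) = 1"
        using lqn dqn that unfolding const by (simp add: coeff_pCons split: nat.split)
    qed
    have qs: "degree (q - [:-s:]) = 2" "lead_coeff (q - [:-s:]) = 1"
      by (simp_all add: q_def)
    have lR: "lead_coeff R = 1"
      using dl(2) qs(2) unfolding eq lead_coeff_mult by simp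
    have "2 * n = 2 + degree R"
      using dl(1) qs lR unfolding eq by (subst (asm) degree_mult_eq) auto
    then have "degree R = 2 * (n - 1)"
      by simp
    \<comment> \<open>Minimality of \<open>m\<close> allows \<open>norm_monic_real_poly_ge\<close>
      to be used with \<open>sqrt m\<close> for \<mu>.\<close>
    then have "m ^ (n - 1) = sqrt m ^ degree R"
      using \<open>m > 0\<close> by (simp add: power_mult)
    also have "\<dots> \<le> norm (poly (map_poly of_real R) t)"
      using \<open>m > 0\<close> min lR by (intro norm_monic_real_poly_ge) (auto simp: h_def)
    finally have R: "m ^ (n - 1) \<le> norm (poly (map_poly of_real R) t)" .
    have ev_pow: "poly (map_poly of_real (q ^ n)) t = h a b ^ n" for n
      by (induction n) (simp_all add: poly_map_of_real_mult ev_q)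
    have "poly (map_poly of_real ((q ^ n - [:-s:] ^ n) + [:-s:] ^ n)) t = h a b ^ n"
      by (simp add: ev_pow)
    then have "poly (map_poly of_real (q ^ n - [:-s:] ^ n)) t = h a b ^ n - of_real ((- s) ^ n)"
      unfolding poly_map_of_real_add const by (simp add: map_poly_pCons algebra_simps)
    moreover have "poly (map_poly of_real (q - [:-s:])) t = h a b + of_real s"
      using poly_map_of_real_add[of q "[:s:]" t] by (simp add: ev_q map_poly_pCons diff_conv_add_uminus del: add_uminus_conv_diff)
    ultimately have "(h a b + of_real s) * poly (map_poly of_real R) t
        = h a b ^ n - of_real ((- s) ^ n)"
      using eq by (metis poly_map_of_real_mult)
    then have "norm (h a b + of_real s) * norm (poly (map_poly of_real R) t)
        = norm (h a b ^ n - of_real ((- s) ^ n))"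
      by (metis norm_mult)
    also have "\<dots> \<le> m ^ n + s ^ n"
      by (rule order_trans[OF norm_triangle_ineq4])
         (use w s in \<open>simp add: norm_power power_abs\<close>)
    finally have "norm (h a b + of_real s) * m ^ (n - 1) \<le> m ^ n + s ^ n"
      using R by (meson mult_left_mono norm_ge_zero order_trans)
    also have "\<dots> = (m + m * (s / m) ^ n) * m ^ (n - 1)"
      using \<open>m > 0\<close> that by (cases n) (auto simp: field_simps)
    finally show ?thesis
      using \<open>m > 0\<close> by simp
  qed
  then have ev: "\<forall>\<^sub>F n in sequentially. norm (h a b + of_real s) \<le> m + m * (s / m) ^ n"
    using eventually_gt_at_top[of 0] by (rule eventually_mono[rotated])
  have "(\<lambda>n. m + m * (s / m) ^ n) \<longlonglongrightarrow> m + m * 0"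
    using s \<open>m > 0\<close> by (intro tendsto_intros LIMSEQ_power_zero) auto
  then show ?thesis
    using tendsto_lowerbound[OF _ ev] by simp
qed

text \<open>The norm of the quadratic expression attains a minimum \<open>m\<close> over the real
  pairs. If \<open>m > 0\<close>, adding \<open>m / 2\<close> stays in the family, since
  \<open>b\<close> can be enlarged, and by the preceding lemma and minimality the norm remains
  \<open>m\<close>. Repeating this makes the shift too large.\<close>

lemma real_normed_field_quadratic:
  fixes t :: "'k::real_normed_field"
  shows "\<exists>a b. (t - of_real a)\<^sup>2 + of_real (b\<^sup>2) = 0"
proof -
  define h where "h = (\<lambda>a b. (t - of_real a)\<^sup>2 + of_real (b\<^sup>2))"
  define T where "T = norm t"
  have "T \<ge> 0" by (simp add: T_def)
  have "\<exists>x\<in>cball (0::real \<times> real) (3 * T). \<forall>y\<in>cball 0 (3 * T).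
      norm (h (fst x) (snd x)) \<le> norm (h (fst y) (snd y))"
    unfolding h_def using \<open>T \<ge> 0\<close>
    by (intro continuous_attains_inf continuous_intros) auto
  then obtain p where p: "\<forall>y\<in>cball 0 (3 * T). norm (h (fst p) (snd p)) \<le> norm (h (fst y) (snd y))"
    by blast
  define a b where "a = fst p" and "b = snd p"
  have ab: "norm (h a b) \<le> norm (h (fst y) (snd y))" if "y \<in> cball 0 (3 * T)" for y
    using p that by (simp add: a_def b_def)
  \<comment> \<open>Outside the disc of radius \<open>3 * T\<close> the norm is at least
    \<open>T\<^sup>2\<close>, its value at the origin, so the minimum over the disc is
    global.\<close>
  have far: "norm (h a b) \<le> norm (h c d)" for c d
  proof (cases "(c, d) \<in> cball 0 (3 * T)")
    case False
    define r where "r = sqrt (c\<^sup>2 + d\<^sup>2)"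
    have r: "r > 3 * T" "r\<^sup>2 = c\<^sup>2 + d\<^sup>2" "\<bar>c\<bar> \<le> r"
      using False by (auto simp: r_def norm_prod_def)
    have "norm (h a b) \<le> T\<^sup>2"
      using ab[of "(0, 0)"] \<open>T \<ge> 0\<close> by (simp add: h_def T_def norm_power)
    also have "T\<^sup>2 \<le> r\<^sup>2 - 2 * r * T - T\<^sup>2"
    proof -
      have "r * (r - 2 * T) \<ge> (3 * T) * T"
        using r \<open>T \<ge> 0\<close> by (intro mult_mono) auto
      moreover have "r * (r - 2 * T) = r\<^sup>2 - 2 * r * T" "(3 * T) * T = 3 * T\<^sup>2"
        by (simp_all add: power2_eq_square algebra_simps)
      ultimately show ?thesis
        using zero_le_power2[of T] by linarith
    qed
    also have "\<dots> \<le> r\<^sup>2 - norm (2 * of_real c * t) - norm (t\<^sup>2)"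
      using r \<open>T \<ge> 0\<close> by (simp add: T_def norm_mult norm_power mult_right_mono)
    also have "\<dots> \<le> norm (of_real (r\<^sup>2) - 2 * of_real c * t + t\<^sup>2)"
      using norm_diff_ineq[of "of_real (r\<^sup>2) - 2 * of_real c * t" "t\<^sup>2"]
        norm_triangle_ineq2[of "of_real (r\<^sup>2) :: 'k" "2 * of_real c * t"]
      by (simp only: norm_of_real abs_power2)
    also have "of_real (r\<^sup>2) - 2 * of_real c * t + t\<^sup>2 = h c d"
      unfolding r(2) h_def by (simp add: power2_eq_square algebra_simps)
    finally show ?thesis .
  qed (use ab in auto)
  define m where "m = norm (h a b)"
  have "m = 0"
  proof (rule ccontr)
    assume "m \<noteq> 0"
    then have "m > 0" by (simp add: m_def)
    have "norm (h a b + of_real (real k * (m / 2))) = m" for k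
    proof (induction k)
      case (Suc k)
      define b' where "b' = sqrt (b\<^sup>2 + real k * (m / 2))"
      have b': "h a b + of_real (real k * (m / 2)) = h a b'"
      proof -
        have "b'\<^sup>2 = b\<^sup>2 + real k * (m / 2)"
          using \<open>m > 0\<close> by (simp add: b'_def)
        then show ?thesis
          unfolding h_def by (simp only: of_real_add add.assoc)
      qed
      define b'' where "b'' = sqrt (b\<^sup>2 + real (Suc k) * (m / 2))"
      have b'': "h a b + of_real (real (Suc k) * (m / 2)) = h a b''"
      proof -
        have "b''\<^sup>2 = b\<^sup>2 + real (Suc k) * (m / 2)"
          using \<open>m > 0\<close> by (simp add: b''_def)
        then show ?thesis
          unfolding h_def by (simp only: of_real_add add.assoc)
      qed
      have "norm (h a b' + of_real (m / 2)) \<le> m"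
        using norm_add_real_le_of_minimal[of m t a b' "m / 2"] far Suc \<open>m > 0\<close>
        unfolding b' by (simp add: h_def m_def)
      moreover have "h a b' + of_real (m / 2) = h a b''"
        unfolding b'[symmetric] b''[symmetric] by (simp add: algebra_simps add_divide_distrib)
      ultimately have "norm (h a b'') = m"
        using far[of a b''] by (simp add: m_def)
      then show ?case
        unfolding b'' .
    qed (simp add: m_def)
    \<comment> \<open>Six steps shift by \<open>3 * m\<close>, but two elements of norm
      \<open>m\<close> differ by at most \<open>2 * m\<close>.\<close>
    from this[of 6] have "norm (h a b + of_real (3 * m)) = m"
      by simp
    moreover have "norm (of_real (3 * m) :: 'k) \<le> norm (h a b + of_real (3 * m)) + norm (h a b)"
      using norm_triangle_ineq4[of "h a b + of_real (3 * m)" "h a b"] by simp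
    ultimately show False
      using \<open>m > 0\<close> by (simp add: m_def norm_mult)
  qed
  then show ?thesis
    by (auto simp: m_def h_def)
qed

text \<open>If some \<open>t\<close> is not real, normalizing its quadratic equation gives a
  \<open>j\<close> with square -1. The equation of any other \<open>z\<close> then reads
  \<open>(z - a)\<^sup>2 = (j b)\<^sup>2\<close>, and in a field this leaves only
  \<open>z = a + j b\<close> or \<open>z = a - j b\<close>.\<close>

lemma real_normed_field_cases:
  "\<exists>j::'k::real_normed_field. (j = 0 \<or> j * j = -1) \<and> (\<forall>z. \<exists>a b. z = of_real a + j * of_real b)"
proof (cases "\<forall>z::'k. \<exists>a. z = of_real a")
  case True
  then show ?thesis
    by (intro exI[of _ 0]) auto
next
  case False
  then obtain t :: 'k where t: "\<And>a. t \<noteq> of_real a"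
    by blast
  obtain a b where ab: "(t - of_real a)\<^sup>2 + of_real (b\<^sup>2) = 0"
    using real_normed_field_quadratic by blast
  have "b \<noteq> 0"
    using ab t[of a] by auto
  define j where "j = (t - of_real a) / of_real b"
  have "(t - of_real a)\<^sup>2 = - of_real (b\<^sup>2)"
    using ab by (simp add: eq_neg_iff_add_eq_0)
  then have j: "j * j = -1"
    using \<open>b \<noteq> 0\<close> by (simp add: j_def power2_eq_square)
  moreover have "\<exists>a b. z = of_real a + j * of_real b" for z
  proof -
    obtain a b where "(z - of_real a)\<^sup>2 + of_real (b\<^sup>2) = 0"
      using real_normed_field_quadratic by blast
    then have "(z - of_real a)\<^sup>2 = (j * j) * of_real (b\<^sup>2)"
      unfolding j by (simp add: eq_neg_iff_add_eq_0)
    then have "(z - of_real a)\<^sup>2 = (j * of_real b)\<^sup>2"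
      by (simp add: power2_eq_square ac_simps)
    then have "z - of_real a = j * of_real b \<or> z - of_real a = - (j * of_real b)"
      by (simp add: power2_eq_iff)
    then have "z = of_real a + j * of_real b \<or> z = of_real a + j * of_real (- b)"
      by (auto simp: algebra_simps)
    then show ?thesis
      by blast
  qed
  ultimately show ?thesis
    by blast
qed

section \<open>Separation by functionals\<close>

definition sublinear :: "('v::real_vector \<Rightarrow> real) \<Rightarrow> bool" where
  "sublinear p \<longleftrightarrow> (\<forall>x y. p (x + y) \<le> p x + p y) \<and> (\<forall>c x. c \<ge> 0 \<longrightarrow> p (c *\<^sub>R x) = c * p x)"

lemma sublinear_add: "sublinear p \<Longrightarrow> p (x + y) \<le> p x + p y"
  by (simp add: sublinear_def)

lemma sublinear_scaleR: "sublinear p \<Longrightarrow> c \<ge> 0 \<Longrightarrow> p (c *\<^sub>R x) = c * p x"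
  by (simp add: sublinear_def)

lemma sublinear_0: "sublinear p \<Longrightarrow> p 0 = 0"
  using sublinear_scaleR[of p 0 0] by simp

lemma sublinear_ge_uminus: "sublinear p \<Longrightarrow> - p (- x) \<le> p x"
  using sublinear_add[of p x "- x"] sublinear_0[of p] by simp

text \<open>For sublinear \<open>p\<close> this is the largest sublinear \<open>q\<close> below
  \<open>p\<close> with \<open>q (- x) \<le> - p x\<close>, that is, the largest one forced to be
  linear along \<open>x\<close> with value \<open>p x\<close>.\<close>

definition sublinear_shift :: "('v::real_vector \<Rightarrow> real) \<Rightarrow> 'v \<Rightarrow> 'v \<Rightarrow> real" where
  "sublinear_shift p x y = (INF t\<in>{0..}. p (y + t *\<^sub>R x) - t * p x)"

context
  fixes p :: "'v::real_vector \<Rightarrow> real"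
  assumes p: "sublinear p"
begin

text \<open>Subadditivity on \<open>t x = (y + t x) - y\<close> bounds the set below, so the infimum
  in \<open>sublinear_shift\<close> is a genuine one.\<close>

lemma sublinear_shift_lower: "t \<ge> 0 \<Longrightarrow> - p (- y) \<le> p (y + t *\<^sub>R x) - t * p x"
  using sublinear_add[OF p, of "y + t *\<^sub>R x" "- y"] sublinear_scaleR[OF p, of t x] by simp

lemma sublinear_shift_le: "t \<ge> 0 \<Longrightarrow> sublinear_shift p x y \<le> p (y + t *\<^sub>R x) - t * p x"
  unfolding sublinear_shift_def
  by (rule cINF_lower[OF bdd_belowI2[where m="- p (- y)"]]) (auto intro: sublinear_shift_lower)

lemma sublinear_shift_greatest:
  "(\<And>t. t \<ge> 0 \<Longrightarrow> m \<le> p (y + t *\<^sub>R x) - t * p x) \<Longrightarrow> m \<le> sublinear_shift p x y"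
  unfolding sublinear_shift_def by (rule cINF_greatest) auto

lemma sublinear_shift_le_self: "sublinear_shift p x y \<le> p y"
  using sublinear_shift_le[of 0] by simp

text \<open>For subadditivity the parameters of the two infima are added. For homogeneity the
  parameter is rescaled, once with \<open>c\<close> and once with its inverse.\<close>

lemma sublinear_sublinear_shift: "sublinear (sublinear_shift p x)"
  unfolding sublinear_def
proof (intro conjI allI impI)
  fix y z
  have "sublinear_shift p x (y + z) - (p (z + t *\<^sub>R x) - t * p x) \<le> p (y + s *\<^sub>R x) - s * p x"
    if "s \<ge> 0" "t \<ge> 0" for s t
    using sublinear_shift_le[of "s + t" x "y + z"] that
      sublinear_add[OF p, of "y + s *\<^sub>R x" "z + t *\<^sub>R x"]
    by (simp add: algebra_simps)
  then have "sublinear_shift p x (y + z) - (p (z + t *\<^sub>R x) - t * p x) \<le> sublinear_shift p x y"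
    if "t \<ge> 0" for t
    using that by (intro sublinear_shift_greatest) auto
  then have "sublinear_shift p x (y + z) - sublinear_shift p x y \<le> p (z + t *\<^sub>R x) - t * p x"
    if "t \<ge> 0" for t
    using that by (simp add: algebra_simps)
  then have "sublinear_shift p x (y + z) - sublinear_shift p x y \<le> sublinear_shift p x z"
    by (rule sublinear_shift_greatest)
  then show "sublinear_shift p x (y + z) \<le> sublinear_shift p x y + sublinear_shift p x z"
    by simp
next
  have le: "sublinear_shift p x (c *\<^sub>R y) \<le> c * sublinear_shift p x y" if "c > 0" for c y
  proof -
    have "sublinear_shift p x (c *\<^sub>R y) / c \<le> p (y + t *\<^sub>R x) - t * p x" if "t \<ge> 0" for t
    proof -
      have "c *\<^sub>R y + (c * t) *\<^sub>R x = c *\<^sub>R (y + t *\<^sub>R x)"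
        by (simp add: scaleR_right_distrib)
      then have "sublinear_shift p x (c *\<^sub>R y) \<le> c * p (y + t *\<^sub>R x) - c * t * p x"
        using sublinear_shift_le[of "c * t" x "c *\<^sub>R y"] that \<open>c > 0\<close>
        by (simp add: sublinear_scaleR[OF p])
      then show ?thesis
        using \<open>c > 0\<close> by (simp add: field_simps)
    qed
    then have "sublinear_shift p x (c *\<^sub>R y) / c \<le> sublinear_shift p x y"
      by (rule sublinear_shift_greatest)
    then show ?thesis
      using that by (simp add: field_simps)
  qed
  fix c :: real and y
  assume "c \<ge> 0"
  show "sublinear_shift p x (c *\<^sub>R y) = c * sublinear_shift p x y"
  proof (cases "c = 0")
    case True
    have "0 \<le> sublinear_shift p x 0"
      by (rule sublinear_shift_greatest) (simp add: sublinear_scaleR[OF p])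
    then show ?thesis
      using True sublinear_shift_le_self[of x 0] sublinear_0[OF p] by simp
  next
    case False
    then have "c > 0"
      using \<open>c \<ge> 0\<close> by simp
    then show ?thesis
      using le[of c y] le[of "inverse c" "c *\<^sub>R y"] by (simp add: field_simps)
  qed
qed

end

text \<open>A minimal sublinear functional \<open>m\<close> coincides with all its shifts, which forces additivity.\<close>

theorem sublinear_dominates_linear:
  fixes p :: "'v::real_vector \<Rightarrow> real"
  assumes p: "sublinear p"
  shows "\<exists>g. linear g \<and> (\<forall>x. g x \<le> p x)"
proof -
  define Z where "Z = {q. sublinear q \<and> q \<le> p}"
  \<comment> \<open>Zorn's lemma for the reversed order; the pointwise infimum bounds a nonempty
    chain.\<close>
  have "\<exists>m\<in>Z. \<forall>q\<in>Z. q \<le> m \<longrightarrow> q = m"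
  proof (rule predicate_Zorn[where P = "\<lambda>a b. b \<le> a"])
    show "partial_order_on Z (relation_of (\<lambda>a b. b \<le> a) Z)"
      by (rule partial_order_on_relation_ofI) auto
  next
    fix C
    assume "C \<in> Chains (relation_of (\<lambda>a b. b \<le> a) Z)"
    then have C: "C \<subseteq> Z" and chain: "\<And>a b. a \<in> C \<Longrightarrow> b \<in> C \<Longrightarrow> a \<le> b \<or> b \<le> a"
      by (auto simp: Chains_def relation_of_def)
    show "\<exists>u\<in>Z. \<forall>a\<in>C. u \<le> a"
    proof (cases "C = {}")
      case True
      then show ?thesis
        using p by (auto simp: Z_def)
    next
      case False
      define u where "u = (\<lambda>x. INF q\<in>C. q x)"
      have q: "sublinear q" "q \<le> p" if "q \<in> C" for q
        using C that by (auto simp: Z_def)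
      have low: "- p (- x) \<le> q x" if "q \<in> C" for q x
        using sublinear_ge_uminus[OF q(1)[OF that], of x] le_funD[OF q(2)[OF that], of "- x"]
        by linarith
      have lower: "u x \<le> q x" if "q \<in> C" for q x
        unfolding u_def using low that by (intro cINF_lower bdd_belowI2[where m="- p (- x)"])
      have greatest: "m \<le> u x" if "\<And>q. q \<in> C \<Longrightarrow> m \<le> q x" for m x
        unfolding u_def using that False by (intro cINF_greatest)
      have "sublinear u"
        unfolding sublinear_def
      proof (intro conjI allI impI)
        fix x y
        \<comment> \<open>The smaller of two comparable members serves for both arguments, so
          subadditivity of a single member is enough.\<close>
        have *: "u (x + y) - r y \<le> q x" if "q \<in> C" "r \<in> C" for q r
        proof (cases "q \<le> r")
          case True
          then show ?thesis
            using lower[OF that(1), of "x + y"] sublinear_add[OF q(1)[OF that(1)], of x y]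
              le_funD[OF True, of y] by linarith
        next
          case False
          then have "r \<le> q"
            using chain that by blast
          then show ?thesis
            using lower[OF that(2), of "x + y"] sublinear_add[OF q(1)[OF that(2)], of x y]
              le_funD[of r q x] by linarith
        qed
        then have "u (x + y) - r y \<le> u x" if "r \<in> C" for r
          using that by (intro greatest)
        then have "u (x + y) - u x \<le> r y" if "r \<in> C" for r
          using that by (simp add: algebra_simps)
        then have "u (x + y) - u x \<le> u y"
          by (rule greatest)
        then show "u (x + y) \<le> u x + u y"
          by simp
      next
        fix c :: real and x
        assume "c \<ge> 0"
        have "u (c *\<^sub>R x) = (INF q\<in>C. c * q x)"
          unfolding u_def using q \<open>c \<ge> 0\<close> by (intro INF_cong) (auto simp: sublinear_scaleR)
        also have "\<dots> = c * u x"
        proof (rule antisym)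
          show "c * u x \<le> (INF q\<in>C. c * q x)"
            using False lower \<open>c \<ge> 0\<close> by (intro cINF_greatest) (auto intro: mult_left_mono)
          show "(INF q\<in>C. c * q x) \<le> c * u x"
          proof (cases "c = 0")
            case True
            then show ?thesis using False by simp
          next
            case c: False
            have bdd: "bdd_below ((\<lambda>q. c * q x) ` C)"
              using low \<open>c \<ge> 0\<close> by (intro bdd_belowI2[where m="c * - p (- x)"] mult_left_mono) auto
            have "(INF q\<in>C. c * q x) / c \<le> u x"
              using cINF_lower[OF bdd] c \<open>c \<ge> 0\<close>
              by (intro greatest) (simp add: field_simps)
            then show ?thesis
              using c \<open>c \<ge> 0\<close> by (simp add: field_simps)
          qed
        qed
        finally show "u (c *\<^sub>R x) = c * u x" .
      qed
      moreover have "u \<le> p"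
        using False lower q(2) by (meson ex_in_conv le_funD le_funI order_trans)
      ultimately show ?thesis
        using lower by (auto simp: Z_def intro!: bexI[of _ u] le_funI)
    qed
  qed
  then obtain m where m: "sublinear m" "m \<le> p" and min: "\<And>q. sublinear q \<Longrightarrow> q \<le> m \<Longrightarrow> q = m"
    by (fastforce simp: Z_def)
  have "sublinear_shift m x = m" for x
    using sublinear_sublinear_shift[OF m(1)] sublinear_shift_le_self[OF m(1)]
    by (intro min le_funI)
  then have "m y \<le> m (y + x) - m x" for x y
    using sublinear_shift_le[OF m(1), of 1 x y] by simp
  then have add: "m (x + y) = m x + m y" for x y
    using sublinear_add[OF m(1), of x y] by (metis add.commute add_le_cancel_right
      diff_add_cancel le_diff_eq order_antisym)
  have neg: "m (- x) = - m x" for x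
    using add[of x "- x"] sublinear_0[OF m(1)] by simp
  have "m (c *\<^sub>R x) = c * m x" for c x
    using sublinear_scaleR[OF m(1), of c x] sublinear_scaleR[OF m(1), of "- c" x] neg[of "c *\<^sub>R x"]
    by (cases "c \<ge> 0") auto
  then have "linear m"
    using add by (intro linearI) auto
  then show ?thesis
    using m(2) by (auto dest: le_funD)
qed

text \<open>A linear minorant \<open>g\<close> of the shift at \<open>x0\<close> satisfies
  \<open>g (- x0) \<le> - p x0\<close>, which turns domination into equality at
  \<open>x0\<close>.\<close>

corollary sublinear_supporting_linear:
  fixes p :: "'v::real_vector \<Rightarrow> real"
  assumes p: "sublinear p"
  shows "\<exists>g. linear g \<and> (\<forall>x. g x \<le> p x) \<and> g x0 = p x0"
proof -
  obtain g where g: "linear g" "\<And>x. g x \<le> sublinear_shift p x0 x"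
    using sublinear_dominates_linear[OF sublinear_sublinear_shift[OF p]] by blast
  have le: "g x \<le> p x" for x
    using g(2) sublinear_shift_le_self[OF p] order_trans by blast
  have "g (- x0) \<le> - p x0"
    using g(2)[of "- x0"] sublinear_shift_le[OF p, of 1 x0 "- x0"] sublinear_0[OF p] by simp
  then show ?thesis
    using g(1) le[of x0] le by (intro exI[of _ g]) (auto simp: linear_neg)
qed

section \<open>Separation of a point from a subspace over the scalar field\<close>

lemma exists_dist_less_infdist:
  fixes x :: "'v::metric_space"
  assumes "N \<noteq> {}" "e > 0"
  shows "\<exists>n\<in>N. dist x n < infdist x N + e"
  using assms cInf_lessD[of "dist x ` N" "infdist x N + e"] by (auto simp: infdist_def)

lemma sublinear_infdist_subspace:
  fixes N :: "'v::real_normed_vector set"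
  assumes N: "subspace N"
  shows "sublinear (\<lambda>x. infdist x N)"
  unfolding sublinear_def
proof (intro conjI allI impI)
  have ne: "N \<noteq> {}"
    using N by (auto simp: subspace_def)
  fix x y
  show "infdist (x + y) N \<le> infdist x N + infdist y N"
  proof (rule field_le_epsilon)
    fix e :: real
    assume "e > 0"
    obtain m n where mn: "m \<in> N" "dist x m < infdist x N + e / 2"
        "n \<in> N" "dist y n < infdist y N + e / 2"
      using exists_dist_less_infdist[OF ne, of "e / 2"] \<open>e > 0\<close> by (meson half_gt_zero)
    have "infdist (x + y) N \<le> dist (x + y) (m + n)"
      using mn N by (intro infdist_le) (auto simp: subspace_def)
    also have "\<dots> \<le> dist x m + dist y n"
      by (rule dist_triangle_add)
    finally show "infdist (x + y) N \<le> infdist x N + infdist y N + e"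
      using mn by linarith
  qed
next
  have ne: "N \<noteq> {}"
    using N by (auto simp: subspace_def)
  have le: "infdist (c *\<^sub>R x) N \<le> \<bar>c\<bar> * infdist x N" if "c \<noteq> 0" for c x
  proof -
    have "infdist (c *\<^sub>R x) N / \<bar>c\<bar> \<le> dist x n" if "n \<in> N" for n
    proof -
      have "infdist (c *\<^sub>R x) N \<le> dist (c *\<^sub>R x) (c *\<^sub>R n)"
        using that N by (intro infdist_le) (simp add: subspace_def)
      also have "\<dots> = dist x n * \<bar>c\<bar>"
        by (simp add: dist_norm flip: scaleR_right_diff_distrib)
      finally show ?thesis
        using \<open>c \<noteq> 0\<close> by (simp add: pos_divide_le_eq)
    qed
    then have "infdist (c *\<^sub>R x) N / \<bar>c\<bar> \<le> infdist x N"
      unfolding infdist_notempty[OF ne] by (intro cINF_greatest ne)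
    then show ?thesis
      using that by (simp add: field_simps)
  qed
  fix c :: real and x :: 'v
  assume "c \<ge> 0"
  show "infdist (c *\<^sub>R x) N = c * infdist x N"
  proof (cases "c = 0")
    case True
    then show ?thesis
      using N by (simp add: subspace_def)
  next
    case False
    then show ?thesis
      using \<open>c \<ge> 0\<close> le[of c x] le[of "inverse c" "c *\<^sub>R x"] by (simp add: field_simps)
  qed
qed

text \<open>Multiplying by the conjugate \<open>a + j b\<close> gives
  \<open>a\<^sup>2 + b\<^sup>2\<close>, and the conjugate has norm at most
  \<open>\<bar>a\<bar> + \<bar>b\<bar>\<close>. The constant comes from \<open>\<bar>a\<bar> / 2 *
  (\<bar>a\<bar> + \<bar>b\<bar>) \<le> a\<^sup>2 + b\<^sup>2\<close>.\<close>

lemma norm_of_real_diff_ge: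
  fixes j :: "'k::real_normed_field"
  assumes j: "j = 0 \<or> j * j = -1"
  shows "\<bar>a\<bar> / 2 \<le> norm (of_real a - j * of_real b)"
proof (cases "j = 0")
  case False
  then have jj: "j * j = -1"
    using j by simp
  then have "norm j ^ 2 = 1"
    by (metis norm_minus_cancel norm_mult norm_one power2_eq_square)
  then have nj: "norm j = 1"
    by (simp add: abs_square_eq_1[of "norm j", simplified])
  show ?thesis
  proof (cases "a = 0")
    case False
    have "(of_real a - j * of_real b) * (of_real a + j * of_real b) = of_real (a * a + b * b)"
      using jj by (simp add: algebra_simps) (simp flip: mult.assoc add: jj)
    then have "norm (of_real a - j * of_real b) * norm (of_real a + j * of_real b) = a * a + b * b"
      by (metis norm_mult norm_of_real abs_of_nonneg sum_squares_ge_zero)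
    moreover have "norm (of_real a + j * of_real b) \<le> \<bar>a\<bar> + \<bar>b\<bar>"
      by (rule order_trans[OF norm_triangle_ineq]) (simp add: norm_mult nj)
    ultimately have "a * a + b * b \<le> norm (of_real a - j * of_real b) * (\<bar>a\<bar> + \<bar>b\<bar>)"
      by (metis mult_left_mono norm_ge_zero)
    moreover have "\<bar>a\<bar> / 2 * (\<bar>a\<bar> + \<bar>b\<bar>) \<le> a * a + b * b"
    proof -
      have "0 \<le> (\<bar>a\<bar> - \<bar>b\<bar>)\<^sup>2 + \<bar>a\<bar> * \<bar>a\<bar> + 3 * (\<bar>b\<bar> * \<bar>b\<bar>) "
        by simp
      then show ?thesis
        by (simp add: power2_eq_square algebra_simps)
    qed
    ultimately show ?thesis
      using False by (meson abs_ge_zero add_pos_nonneg mult_right_le_imp_le order_trans zero_less_abs_iff)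
  qed simp
qed simp

text \<open>A real functional supporting the distance to \<open>N\<close> at \<open>x0\<close>
  vanishes on \<open>N\<close> and is dominated by the norm; it is then made linear over the
  scalars. The first 2 counts the two summands of \<open>f\<close>, the second is the loss in
  \<open>norm_of_real_diff_ge\<close>.\<close>

theorem (in normed_space_over) dual_separates_subspace:
  assumes N: "0 \<in> N" "\<And>x y. x \<in> N \<Longrightarrow> y \<in> N \<Longrightarrow> x + y \<in> N" "\<And>c x. x \<in> N \<Longrightarrow> scl c x \<in> N"
  shows "\<exists>f\<in>top_dual scl. (\<forall>x\<in>N. f x = 0) \<and> (\<forall>x. norm (f x) \<le> 2 * norm x) \<and>
    infdist x0 N \<le> 2 * norm (f x0)"
proof -
  have sub: "Real_Vector_Spaces.subspace N"
    using N by (auto simp: real_vector.subspace_def simp flip: scale_of_real)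
  obtain g where lin: "linear g" and le: "\<And>x. g x \<le> infdist x N" and g0: "g x0 = infdist x0 N"
    using sublinear_supporting_linear[OF sublinear_infdist_subspace[OF sub]] by blast
  obtain j :: 'k where j: "j = 0 \<or> j * j = -1" and k: "\<And>z. \<exists>a b. z = of_real a + j * of_real b"
    using real_normed_field_cases by blast
  have nj: "norm j \<le> 1"
  proof (cases "j = 0")
    case False
    then have "norm j * norm j = 1"
      using j by (metis norm_minus_cancel norm_mult norm_one)
    then show ?thesis
      by (metis abs_norm_cancel abs_square_eq_1 order_refl power2_eq_square)
  qed simp
  have gN: "g x = 0" if "x \<in> N" for x
    using le[of x] le[of "- x"] that real_vector.subspace_neg[OF sub that] by (simp add: linear_neg[OF lin])
  have gle: "\<bar>g x\<bar> \<le> norm x" for x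
  proof -
    have "infdist x N \<le> norm x" for x
      using infdist_le[OF N(1), of x] by simp
    then show ?thesis
      using le[of x] le[of "- x"] order_trans by (fastforce simp: linear_neg[OF lin] abs_le_iff)
  qed
  \<comment> \<open>The classical complexification of a real functional, which commutes with
    \<open>j\<close> when \<open>j * j = -1\<close>. For \<open>j = 0\<close> it is \<open>g\<close>
    itself.\<close>
  define f where "f x = of_real (g x) - j * of_real (g (scl j x))" for x
  have scl_of_real: "g (scl (of_real r) x) = r * g x" for r x
    by (simp add: scale_of_real linear_cmul[OF lin])
  have fj: "f (scl j x) = j * f x" for x
  proof (cases "j = 0")
    case True
    then show ?thesis
      by (simp add: f_def linear_0[OF lin])
  next
    case False
    then have jj: "j * j = -1"
      using j by simp
    then show ?thesis
      by (simp add: f_def algebra_simps linear_neg[OF lin] flip: mult.assoc)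
  qed
  have fadd: "f (x + y) = f x + f y" for x y
    by (simp add: f_def scale_right_distrib linear_add[OF lin] algebra_simps)
  have freal: "f (scl (of_real r) x) = of_real r * f x" for r x
    unfolding f_def scale_left_commute[of j] scl_of_real by (simp add: right_diff_distrib mult.left_commute)
  have fscl: "f (scl c x) = c * f x" for c x
  proof -
    obtain a b where "c = of_real a + j * of_real b"
      using k by blast
    then have "f (scl c x) = of_real a * f x + f (scl j (scl (of_real b) x))"
      by (simp add: scale_left_distrib fadd freal)
    then show ?thesis
      using \<open>c = _\<close> by (simp only: fj freal) (simp add: algebra_simps)
  qed
  have fle: "norm (f x) \<le> 2 * norm x" for x
  proof -
    have "norm (f x) \<le> \<bar>g x\<bar> + norm j * \<bar>g (scl j x)\<bar>"
      unfolding f_def by (rule order_trans[OF norm_triangle_ineq4]) (simp add: norm_mult)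
    also have "\<dots> \<le> norm x + 1 * (1 * norm x)"
      using gle[of x] gle[of "scl j x"] nj mult_right_mono[OF nj norm_ge_zero[of x]]
      by (intro add_mono mult_mono) (auto simp: norm_scale)
    finally show ?thesis by simp
  qed
  have "f \<in> top_dual scl"
    unfolding top_dual_def
    using fadd fscl fle by (auto intro!: bounded_linear_intro[of _ 2] simp: scaleR_conv_of_real
        mult.commute simp flip: scale_of_real)
  moreover have "f x = 0" if "x \<in> N" for x
    using that N by (simp add: f_def gN)
  moreover have "infdist x0 N \<le> 2 * norm (f x0)"
    using norm_of_real_diff_ge[OF j, of "g x0" "g (scl j x0)"] g0 by (simp add: f_def infdist_nonneg)
  ultimately show ?thesis
    using fle by blast
qed

section \<open>Duals and biduals\<close>

text \<open>Induction on \<open>X\<close>, subtracting a multiple of \<open>l y\<close> from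
  \<open>L\<close>. The domain is any set closed under \<open>comb\<close>, so that both functionals
  on vectors and evaluations on functionals are covered.\<close>

lemma functional_in_span_of_kernel:
  fixes l :: "'i \<Rightarrow> 'd \<Rightarrow> 'k::field" and comb :: "'d \<Rightarrow> 'k \<Rightarrow> 'd \<Rightarrow> 'd"
  assumes "finite X"
    and comb: "\<And>f g c. f \<in> D \<Longrightarrow> g \<in> D \<Longrightarrow> comb f c g \<in> D"
    and l: "\<And>x f g c. x \<in> X \<Longrightarrow> f \<in> D \<Longrightarrow> g \<in> D \<Longrightarrow> l x (comb f c g) = l x f + c * l x g"
    and L: "\<And>f g c. f \<in> D \<Longrightarrow> g \<in> D \<Longrightarrow> L (comb f c g) = L f + c * L g"
    and ker: "\<And>f. f \<in> D \<Longrightarrow> (\<forall>x\<in>X. l x f = 0) \<Longrightarrow> L f = 0"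
  shows "\<exists>a. \<forall>f\<in>D. L f = (\<Sum>x\<in>X. a x * l x f)"
  using \<open>finite X\<close> l L ker
proof (induction X arbitrary: L)
  case (insert y X)
  have IH: "\<exists>a. \<forall>f\<in>D. M f = (\<Sum>x\<in>X. a x * l x f)"
    if "\<And>f g c. f \<in> D \<Longrightarrow> g \<in> D \<Longrightarrow> M (comb f c g) = M f + c * M g"
      and "\<And>f. f \<in> D \<Longrightarrow> (\<forall>x\<in>X. l x f = 0) \<Longrightarrow> M f = 0" for M
    by (rule insert.IH) (use insert.prems(1) that in auto)
  have "\<exists>b a. \<forall>f\<in>D. L f - b * l y f = (\<Sum>x\<in>X. a x * l x f)"
  proof (cases "\<exists>g\<in>D. (\<forall>x\<in>X. l x g = 0) \<and> l y g \<noteq> 0")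
    case True
    then obtain g where g: "g \<in> D" "\<forall>x\<in>X. l x g = 0" "l y g \<noteq> 0"
      by blast
    \<comment> \<open>With this \<open>b\<close> the difference vanishes at \<open>g\<close>. Since
      \<open>g\<close> is killed by \<open>X\<close> but not by \<open>l y\<close>, any
      \<open>f\<close> killed by \<open>X\<close> can be moved along \<open>g\<close> into the
      kernel of \<open>l y\<close> as well.\<close>
    define b where "b = L g / l y g"
    have "L f - b * l y f = 0" if f: "f \<in> D" "\<forall>x\<in>X. l x f = 0" for f
    proof -
      let ?h = "comb f (- l y f / l y g) g"
      have "l y ?h = 0"
        using f g insert.prems(1)[of y f g] by simp
      moreover have "\<forall>x\<in>X. l x ?h = 0"
        using f g insert.prems(1) by simp
      ultimately have "L ?h = 0"
        using f g comb by (intro insert.prems(3)) auto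
      then show ?thesis
        using f g insert.prems(2) by (simp add: b_def)
    qed
    moreover have "L (comb f c g) - b * l y (comb f c g) = L f - b * l y f + c * (L g - b * l y g)"
      if "f \<in> D" "g \<in> D" for f g c
      using that insert.prems(1)[of y f g c] insert.prems(2)[of f g c] by (simp add: algebra_simps)
    ultimately have "\<exists>a. \<forall>f\<in>D. L f - b * l y f = (\<Sum>x\<in>X. a x * l x f)"
      by (rule IH[rotated])
    then show ?thesis
      by blast
  next
    case False
    then have "L f = 0" if "f \<in> D" "\<forall>x\<in>X. l x f = 0" for f
      using that by (intro insert.prems(3)) auto
    then have "\<exists>a. \<forall>f\<in>D. L f = (\<Sum>x\<in>X. a x * l x f)"
      using insert.prems(2) by (intro IH)
    then show ?thesis
      by (intro exI[of _ 0]) simp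
  qed
  then obtain b a where ba: "\<And>f. f \<in> D \<Longrightarrow> L f = b * l y f + (\<Sum>x\<in>X. a x * l x f)"
    by (metis add.commute diff_add_cancel)
  have "L f = (\<Sum>x\<in>insert y X. (a(y := b)) x * l x f)" if "f \<in> D" for f
  proof -
    have "(\<Sum>x\<in>X. (a(y := b)) x * l x f) = (\<Sum>x\<in>X. a x * l x f)"
      using insert.hyps by (intro sum.cong) auto
    then show ?thesis
      using ba[OF that] insert.hyps by simp
  qed
  then show ?case
    by blast
qed (use ker in auto)

section \<open>Linear algebra and bounds in the dual and the bidual\<close>

lemma top_dualI:
  assumes "\<And>x y. f (x + y) = f x + f y" "\<And>c x. f (scl c x) = c * f x"
    and "\<And>x. norm (f x) \<le> K * norm x" and "normed_space_over scl"
  shows "f \<in> top_dual scl"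
proof -
  interpret normed_space_over scl by fact
  show ?thesis
    unfolding top_dual_def using assms
    by (auto intro!: bounded_linear_intro[of _ K] simp: scaleR_conv_of_real
        mult.commute simp flip: scale_of_real)
qed

lemma top_dualD:
  assumes "f \<in> top_dual scl"
  shows top_dual_bounded_linear: "bounded_linear f"
    and top_dual_add_apply: "f (x + y) = f x + f y"
    and top_dual_diff_apply: "f (x - y) = f x - f y"
    and top_dual_zero_apply: "f 0 = 0"
    and top_dual_scl: "f (scl c x) = c * f x"
proof -
  show f: "bounded_linear f" and "f (scl c x) = c * f x"
    using assms by (auto simp: top_dual_def)
  interpret bounded_linear f by fact
  show "f (x + y) = f x + f y" "f (x - y) = f x - f y" "f 0 = 0"
    by (simp_all add: add diff zero)
qed

lemma top_dual_comb:
  assumes "f \<in> top_dual scl" "g \<in> top_dual scl"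
  shows "(\<lambda>x. f x + c * g x) \<in> top_dual scl"
  using assms by (auto simp: top_dual_def algebra_simps
      intro!: bounded_linear_add bounded_linear_const_mult)

lemma top_dual_zero: "(\<lambda>_. 0) \<in> top_dual scl"
  by (simp add: top_dual_def)

lemma top_dual_cmult: "f \<in> top_dual scl \<Longrightarrow> (\<lambda>x. c * f x) \<in> top_dual scl"
  using top_dual_comb[OF top_dual_zero, of f scl c] by simp

lemma top_dual_add:
  "f \<in> top_dual scl \<Longrightarrow> g \<in> top_dual scl \<Longrightarrow> (\<lambda>x. f x + g x) \<in> top_dual scl"
  using top_dual_comb[of f scl g 1] by simp

lemma top_dual_sum_scl:
  assumes "f \<in> top_dual scl"
  shows "f (\<Sum>i\<in>I. scl (a i) (v i)) = (\<Sum>i\<in>I. a i * f (v i))"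
  by (simp add: linear_sum[OF bounded_linear.linear[OF top_dual_bounded_linear[OF assms]]]
      top_dual_scl[OF assms])

lemma top_bidual_add:
  "F \<in> top_bidual scl \<Longrightarrow> f \<in> top_dual scl \<Longrightarrow> g \<in> top_dual scl \<Longrightarrow> F (\<lambda>x. f x + g x) = F f + F g"
  by (auto simp: top_bidual_def)

lemma top_bidual_cmult:
  "F \<in> top_bidual scl \<Longrightarrow> f \<in> top_dual scl \<Longrightarrow> F (\<lambda>x. c * f x) = c * F f"
  by (auto simp: top_bidual_def)

lemma top_bidual_comb:
  assumes "F \<in> top_bidual scl" "f \<in> top_dual scl" "g \<in> top_dual scl"
  shows "F (\<lambda>x. f x + c * g x) = F f + c * F g"
  using top_bidual_add[OF assms(1,2) top_dual_cmult[OF assms(3)]] top_bidual_cmult[OF assms(1,3)]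
  by simp

lemma top_bidual_zero: "F \<in> top_bidual scl \<Longrightarrow> F (\<lambda>_. 0) = 0"
  using top_bidual_cmult[OF _ top_dual_zero, of F scl 0] by simp

lemma top_bidual_sum:
  assumes F: "F \<in> top_bidual scl" and "finite I" "\<And>i. i \<in> I \<Longrightarrow> f i \<in> top_dual scl"
  shows "(\<lambda>x. \<Sum>i\<in>I. a i * f i x) \<in> top_dual scl \<and> F (\<lambda>x. \<Sum>i\<in>I. a i * f i x) = (\<Sum>i\<in>I. a i * F (f i))"
  using assms(2,3)
proof (induction I)
  case empty
  then show ?case
    by (simp add: top_dual_zero top_bidual_zero[OF F])
next
  case (insert j I)
  then show ?case
    using top_bidual_comb[OF F, of "\<lambda>x. \<Sum>i\<in>I. a i * f i x" "f j" "a j"]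
      top_dual_comb[of "\<lambda>x. \<Sum>i\<in>I. a i * f i x" scl "f j" "a j"]
    by (simp add: add.commute)
qed

text \<open>Trades \<open>onorm\<close> for an arbitrary bound \<open>K\<close>, which is what
  estimates of concrete functionals supply.\<close>

lemma top_bidual_bound:
  assumes "F \<in> top_bidual scl"
  obtains C where "C \<ge> 0"
    "\<And>f K. f \<in> top_dual scl \<Longrightarrow> K \<ge> 0 \<Longrightarrow> (\<And>x. norm (f x) \<le> K * norm x) \<Longrightarrow> norm (F f) \<le> C * K"
proof -
  obtain C where C: "\<forall>f\<in>top_dual scl. norm (F f) \<le> C * onorm f"
    using assms unfolding top_bidual_def by blast
  have "norm (F f) \<le> \<bar>C\<bar> * K"
    if "f \<in> top_dual scl" "K \<ge> 0" "\<And>x. norm (f x) \<le> K * norm x" for f K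
  proof -
    have "norm (F f) \<le> C * onorm f"
      using C that by simp
    also have "\<dots> \<le> \<bar>C\<bar> * onorm f"
      using onorm_pos_le[OF top_dual_bounded_linear[OF that(1)]] by (intro mult_right_mono) auto
    also have "\<dots> \<le> \<bar>C\<bar> * K"
      using that by (intro mult_left_mono onorm_bound) auto
    finally show ?thesis .
  qed
  then show thesis
    using that[of "\<bar>C\<bar>"] by simp
qed

text \<open>Helly's theorem with exact agreement and a bound independent of \<open>I\<close>. Linear
  algebra yields some solution; separation bounds its distance to the common kernel of
  \<open>I\<close>, and subtracting a nearby kernel element makes it short.\<close>

lemma (in normed_space_over) bidual_agrees_on_finite:
  assumes F: "F \<in> top_bidual scl"
  obtains C where "\<And>I. finite I \<Longrightarrow> I \<subseteq> top_dual scl \<Longrightarrow> \<exists>v. norm v \<le> C \<and> (\<forall>f\<in>I. f v = F f)"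
proof -
  obtain C where C: "C \<ge> 0"
    "\<And>f K. f \<in> top_dual scl \<Longrightarrow> K \<ge> 0 \<Longrightarrow> (\<And>x. norm (f x) \<le> K * norm x) \<Longrightarrow> norm (F f) \<le> C * K"
    using top_bidual_bound[OF F] by blast
  have span: "\<exists>a. \<forall>v\<in>UNIV. f v = (\<Sum>g\<in>I. a g * g v)"
    if "finite I" "I \<subseteq> top_dual scl" "f \<in> top_dual scl" "\<And>v. (\<forall>g\<in>I. g v = 0) \<Longrightarrow> f v = 0" for f I
    by (rule functional_in_span_of_kernel[where comb = "\<lambda>x c y. x + scl c y"])
       (use that in \<open>auto simp: top_dual_add_apply[of _ scl] top_dual_scl[of _ scl] subset_iff\<close>)
  \<comment> \<open>A functional that vanishes on the common kernel of \<open>I\<close> is a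
    combination of members of \<open>I\<close>, so agreement on \<open>I\<close> passes to
    it.\<close>
  have combF: "f v = F f" if I: "finite I" "I \<subseteq> top_dual scl" and f: "f \<in> top_dual scl"
      "\<And>v. (\<forall>g\<in>I. g v = 0) \<Longrightarrow> f v = 0" and v: "\<forall>g\<in>I. g v = F g" for f I v
  proof -
    obtain a where a: "f = (\<lambda>v. \<Sum>g\<in>I. a g * g v)"
      using span[OF I f] by blast
    have "F f = (\<Sum>g\<in>I. a g * F g)"
      unfolding a using I top_bidual_sum[OF F, of I "\<lambda>g. g" a] by blast
    also have "\<dots> = f v"
      unfolding a using v by simp
    finally show ?thesis ..
  qed
  have ex: "\<exists>v. \<forall>f\<in>I. f v = F f" if "finite I" "I \<subseteq> top_dual scl" for I
    using that
  proof (induction I)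
    case (insert f I)
    then obtain v where v: "\<forall>g\<in>I. g v = F g" and f: "f \<in> top_dual scl"
      by auto
    show ?case
    proof (cases "\<forall>u. (\<forall>g\<in>I. g u = 0) \<longrightarrow> f u = 0")
      case True
      then have "f v = F f"
        using insert v by (intro combF[of I]) auto
      then show ?thesis
        using v by auto
    next
      case False
      then obtain u where u: "\<forall>g\<in>I. g u = 0" "f u \<noteq> 0"
        by blast
      let ?w = "v + scl ((F f - f v) / f u) u"
      have "f ?w = F f"
        using f u by (simp add: top_dual_add_apply[of _ scl] top_dual_scl[of _ scl])
      moreover have "\<forall>g\<in>I. g ?w = F g"
        using insert.prems u v by (auto simp: top_dual_add_apply[of _ scl] top_dual_scl[of _ scl] subset_iff)
      ultimately show ?thesis
        by blast
    qed
  qed simp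
  \<comment> \<open>The 4 is the product of the two constants 2 in
    \<open>dual_separates_subspace\<close>; the 1 is slack because the distance need not be
    attained.\<close>
  have "\<exists>v. norm v \<le> 4 * C + 1 \<and> (\<forall>f\<in>I. f v = F f)" if I: "finite I" "I \<subseteq> top_dual scl" for I
  proof -
    obtain v where v: "\<forall>f\<in>I. f v = F f"
      using ex[OF I] by blast
    define N where "N = {u. \<forall>f\<in>I. f u = 0}"
    have "0 \<in> N" "\<And>x y. x \<in> N \<Longrightarrow> y \<in> N \<Longrightarrow> x + y \<in> N" "\<And>c x. x \<in> N \<Longrightarrow> scl c x \<in> N"
      using I by (auto simp: N_def subset_iff top_dual_add_apply[of _ scl] top_dual_scl[of _ scl] top_dual_zero_apply[of _ scl])
    then obtain f where f: "f \<in> top_dual scl" "\<forall>x\<in>N. f x = 0" "\<And>x. norm (f x) \<le> 2 * norm x"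
        "infdist v N \<le> 2 * norm (f v)"
      using dual_separates_subspace[of N v] by blast
    have "f v = F f"
      using I f v by (intro combF[of I]) (auto simp: N_def)
    then have "norm (f v) \<le> C * 2"
      using C(2)[OF f(1) _ f(3)] by simp
    then have "infdist v N \<le> 4 * C"
      using f(4) by simp
    then obtain u where u: "u \<in> N" "dist v u < 4 * C + 1"
      using exists_dist_less_infdist[of N 1 v] \<open>0 \<in> N\<close> by force
    have "\<forall>f\<in>I. f (v - u) = F f"
      using u v I by (auto simp: N_def top_dual_diff_apply[of _ scl] subset_iff)
    then show ?thesis
      using u by (intro exI[of _ "v - u"]) (auto simp: dist_norm)
  qed
  then show thesis
    using that by blast
qed

section \<open>Weak and weak* limits\<close>

lemma limitin_weak_dual_eval:
  assumes lim: "limitin (weak_dual scl) h f N" and F: "F \<in> top_bidual scl"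
  shows "((\<lambda>i. F (h i)) \<longlongrightarrow> F f) N"
proof -
  have "continuous_map (product_topology (\<lambda>_. euclidean) (top_bidual scl)) euclidean (\<lambda>G. G F)"
    using F by (rule continuous_map_product_projection)
  then have "continuous_map (weak_dual scl) euclidean ((\<lambda>G. G F) \<circ> (\<lambda>f. \<lambda>F\<in>top_bidual scl. F f))"
    unfolding weak_dual_def by (rule continuous_map_pullback)
  from continuous_map_limit[OF this lim] show ?thesis
    using F by (simp add: o_def limitin_canonical_iff)
qed

text \<open>Along the net of functionals that eventually kill each \<open>T x\<close>, the
  compositions with \<open>T\<close> tend to 0 weak*, hence weakly. So \<open>F\<close> is small,
  and by scaling zero, on the compositions of those \<open>f\<close> that kill finitely many
  \<open>T x\<close>. Then it is a combination of finitely many evaluations.\<close>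

lemma weak_star_weak_representable:
  assumes scl: "normed_space_over scl"
    and T: "\<And>f. f \<in> top_dual scl \<Longrightarrow> (\<lambda>x. f (T x)) \<in> top_dual scl"
    and ww: "\<And>N. \<forall>\<^sub>F f in N. f \<in> top_dual scl \<Longrightarrow>
      limitin (weak_star_dual scl) (\<lambda>f x. f (T x)) (\<lambda>_. 0) N \<Longrightarrow>
      limitin (weak_dual scl) (\<lambda>f x. f (T x)) (\<lambda>_. 0) N"
    and F: "F \<in> top_bidual scl"
  shows "\<exists>v. \<forall>f\<in>top_dual scl. F (\<lambda>x. f (T x)) = f (T v)"
proof -
  define A where "A x = {f \<in> top_dual scl. f (T x) = 0}" for x
  \<comment> \<open>Every \<open>A x\<close> is closed under scaling, so this net carries no norm
    bound.\<close>
  define N where "N = (INF x. principal (A x))"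
  have ev: "\<forall>\<^sub>F f in N. f \<in> A x" for x
  proof -
    have "N \<le> principal (A x)"
      unfolding N_def by (rule INF_lower) simp
    then show ?thesis
      by (simp add: le_principal)
  qed
  then have D: "\<forall>\<^sub>F f in N. f \<in> top_dual scl"
    using eventually_mono[OF ev[of undefined]] by (auto simp: A_def)
  have "((\<lambda>f. f (T x)) \<longlongrightarrow> 0) N" for x
    using ev[of x] by (intro tendsto_eventually) (auto simp: A_def elim: eventually_mono)
  then have "limitin (weak_star_dual scl) (\<lambda>f x. f (T x)) (\<lambda>_. 0) N"
    unfolding weak_star_dual_def
    using T by (subst limitin_subtopology, subst limitin_componentwise)
      (auto simp: top_dual_zero intro: eventually_mono[OF D])
  then have "((\<lambda>f. F (\<lambda>x. f (T x))) \<longlongrightarrow> F (\<lambda>_. 0)) N"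
    using ww[OF D] F by (intro limitin_weak_dual_eval)
  then have "\<forall>\<^sub>F f in N. norm (F (\<lambda>x. f (T x))) < 1"
    using top_bidual_zero[OF F] by (auto simp: tendsto_iff dest: spec[of _ 1])
  then obtain X where X: "finite X" "\<forall>\<^sub>F f in (INF x\<in>X. principal (A x)). norm (F (\<lambda>x. f (T x))) < 1"
    unfolding N_def using eventually_INF[THEN iffD1, of "\<lambda>f. norm (F (\<lambda>x. f (T x))) < 1" "\<lambda>x. principal (A x)" UNIV]
    by metis
  have small: "norm (F (\<lambda>x. f (T x))) < 1" if "f \<in> top_dual scl" "\<forall>x\<in>X. f (T x) = 0" for f
  proof -
    have "\<forall>f\<in>(\<Inter>x\<in>X. A x). norm (F (\<lambda>x. f (T x))) < 1"
      using X(2) unfolding INF_principal_finite[OF X(1)] eventually_principal .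
    moreover have "f \<in> (\<Inter>x\<in>X. A x)"
      using that unfolding A_def by blast
    ultimately show ?thesis
      by (rule bspec)
  qed
  have "\<exists>a. \<forall>f\<in>top_dual scl. F (\<lambda>x. f (T x)) = (\<Sum>x\<in>X. a x * f (T x))"
  proof (rule functional_in_span_of_kernel[where comb = "\<lambda>f c g x. f x + c * g x"])
    fix f
    assume f: "f \<in> top_dual scl" "\<forall>x\<in>X. f (T x) = 0"
    show "F (\<lambda>x. f (T x)) = 0"
    proof (rule ccontr)
      assume nz: "F (\<lambda>x. f (T x)) \<noteq> 0"
      \<comment> \<open>Rescaled to value 1, the functional still kills all \<open>T x\<close> with
        \<open>x\<close> in \<open>X\<close>, contrary to \<open>small\<close>.\<close>
      let ?c = "inverse (F (\<lambda>x. f (T x)))"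
      have "norm (F (\<lambda>x. ?c * f (T x))) < 1"
        using f by (intro small[of "\<lambda>x. ?c * f x"]) (auto intro: top_dual_cmult)
      then show False
        using nz by (simp add: top_bidual_cmult[OF F T[OF f(1)]])
    qed
  next
    show "F (\<lambda>x. f (T x) + c * g (T x)) = F (\<lambda>x. f (T x)) + c * F (\<lambda>x. g (T x))"
      if "f \<in> top_dual scl" "g \<in> top_dual scl" for f g c
      using that by (intro top_bidual_comb[OF F] T)
  qed (use X(1) in \<open>simp_all add: top_dual_comb\<close>)
  then obtain a where a: "\<And>f. f \<in> top_dual scl \<Longrightarrow> F (\<lambda>x. f (T x)) = (\<Sum>x\<in>X. a x * f (T x))"
    by blast
  have "F (\<lambda>x. f (T x)) = f (T (\<Sum>x\<in>X. scl (a x) x))" if "f \<in> top_dual scl" for f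
    using a[OF that] top_dual_sum_scl[OF T[OF that], of a "\<lambda>x. x" X] by simp
  then show ?thesis
    by blast
qed

text \<open>The coordinates of a cluster point of \<open>i \<mapsto> (h i)\<^sub>h\<close> in a product of balls are limits
  along a common finer filter; this replaces a limit along an ultrafilter.\<close>

lemma finer_filter_bounded_convergent:
  fixes F :: "'i filter"
  assumes "F \<noteq> bot"
  obtains U where "U \<le> F" "U \<noteq> bot"
    "\<And>h C. \<forall>\<^sub>F i in F. norm (h i :: 'k::{real_normed_field,heine_borel}) \<le> C \<Longrightarrow> \<exists>l. (h \<longlongrightarrow> l) U"
proof -
  define C where "C h = (SOME C. \<forall>\<^sub>F i in F. norm (h i :: 'k) \<le> C)" for h
  \<comment> \<open>Truncation at the chosen bound puts every \<open>s i\<close> into the compact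
    product \<open>K\<close>. For an eventually bounded \<open>h\<close> it eventually changes
    nothing.\<close>
  define s where "s i h = (if norm (h i :: 'k) \<le> C h then h i else 0)" for i h
  define K where "K = (\<Pi>\<^sub>E h\<in>UNIV. cball (0::'k) \<bar>C h\<bar>)"
  have "compactin (product_topology (\<lambda>_. euclidean) UNIV) K"
    unfolding K_def compactin_PiE by simp
  then have "compact K"
    by (simp add: euclidean_product_topology)
  moreover have "s i \<in> K" for i
    by (auto simp: K_def s_def)
  then have "\<forall>\<^sub>F x in filtermap s F. x \<in> K"
    by (simp add: eventually_filtermap)
  moreover have "filtermap s F \<noteq> bot"
    using assms by (simp add: filtermap_bot_iff)
  ultimately obtain p where p: "inf (nhds p) (filtermap s F) \<noteq> bot"
    unfolding compact_filter by blast
  \<comment> \<open>Along this filter \<open>s\<close> converges to the cluster point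
    \<open>p\<close>; it is proper precisely because \<open>p\<close> is a cluster point.\<close>
  define U where "U = inf F (filtercomap s (nhds p))"
  have "U \<noteq> bot"
  proof
    assume "U = bot"
    then obtain P Q where PQ: "eventually P F" "eventually Q (nhds p)" "\<And>i. P i \<Longrightarrow> \<not> Q (s i)"
      unfolding U_def trivial_limit_def eventually_inf eventually_filtercomap by blast
    then have "eventually (\<lambda>x. \<not> Q x) (filtermap s F)"
      by (auto simp: eventually_filtermap elim: eventually_mono)
    then have "eventually (\<lambda>_. False) (inf (nhds p) (filtermap s F))"
      using PQ(2) unfolding eventually_inf by blast
    then show False
      using p by (simp add: trivial_limit_def)
  qed
  moreover have "U \<le> F"
    by (simp add: U_def)
  moreover have "\<exists>l. (h \<longlongrightarrow> l) U" if h: "\<forall>\<^sub>F i in F. norm (h i :: 'k) \<le> B" for h B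
  proof -
    have "\<forall>\<^sub>F i in F. norm (h i) \<le> C h"
      unfolding C_def by (rule someI[of _ B]) (rule h)
    then have "\<forall>\<^sub>F i in F. s i h = h i"
      by (rule eventually_mono) (simp add: s_def)
    then have eq: "\<forall>\<^sub>F i in U. s i h = h i"
      by (rule filter_leD[OF \<open>U \<le> F\<close>])
    have "(s \<longlongrightarrow> p) U"
      by (simp add: U_def filterlim_def filtermap_le_iff_le_filtercomap)
    then have "limitin (product_topology (\<lambda>_. euclidean) UNIV) s p U"
      by (simp add: euclidean_product_topology)
    then have "((\<lambda>i. s i h) \<longlongrightarrow> p h) U"
      by (subst (asm) limitin_componentwise) simp
    then show ?thesis
      using tendsto_cong[OF eq] by blast
  qed
  ultimately show thesis
    using that by blast
qed

lemma pointwise_limit_in_top_dual: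
  assumes "normed_space_over scl" "U \<noteq> bot"
    and "\<And>i. f i \<in> top_dual scl" "\<And>i x. norm (f i x) \<le> K * norm x"
    and lim: "\<And>x. ((\<lambda>i. f i x) \<longlongrightarrow> g x) U"
  shows "g \<in> top_dual scl"
proof (rule top_dualI)
  show "g (x + y) = g x + g y" for x y
    using assms tendsto_add[OF lim lim, of x y]
    by (intro tendsto_unique[OF _ lim[of "x + y"]]) (auto simp: top_dual_add_apply[of _ scl])
  show "g (scl c x) = c * g x" for c x
    using assms tendsto_mult_left[OF lim, of c x]
    by (intro tendsto_unique[OF _ lim[of "scl c x"]]) (auto simp: top_dual_scl[of _ scl])
  show "norm (g x) \<le> K * norm x" for x
    using assms by (intro tendsto_upperbound[OF tendsto_norm[OF lim]]) auto
qed fact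

text \<open>Linearity and the bound pass to limits of evaluations; \<open>restrict\<close> meets the
  convention that bidual elements are extensional.\<close>

lemma eval_limit_in_top_bidual:
  assumes "U \<noteq> bot" and v: "\<forall>\<^sub>F i in U. norm (v i) \<le> C"
    and lim: "\<And>f. f \<in> top_dual scl \<Longrightarrow> ((\<lambda>i. f (v i)) \<longlongrightarrow> G f) U"
  shows "restrict G (top_dual scl) \<in> top_bidual scl"
proof -
  have "norm (G f) \<le> C * onorm f" if f: "f \<in> top_dual scl" for f
  proof (rule tendsto_upperbound[OF tendsto_norm[OF lim[OF f]] _ \<open>U \<noteq> bot\<close>])
    have "norm (f (v i)) \<le> C * onorm f" if "norm (v i) \<le> C" for i
      using onorm[OF top_dual_bounded_linear[OF f], of "v i"] that
        onorm_pos_le[OF top_dual_bounded_linear[OF f]]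
      by (metis mult.commute mult_left_mono order_trans)
    then show "\<forall>\<^sub>F i in U. norm (f (v i)) \<le> C * onorm f"
      using v by (auto elim: eventually_mono)
  qed
  moreover have "G (\<lambda>x. f x + g x) = G f + G g" if "f \<in> top_dual scl" "g \<in> top_dual scl" for f g
    using that by (intro tendsto_unique[OF \<open>U \<noteq> bot\<close> lim[of "\<lambda>x. f x + g x"]] tendsto_add lim top_dual_add)
  moreover have "G (\<lambda>x. c * f x) = c * G f" if "f \<in> top_dual scl" for f c
    using that by (intro tendsto_unique[OF \<open>U \<noteq> bot\<close> lim[of "\<lambda>x. c * f x"]] tendsto_mult_left lim top_dual_cmult)
  ultimately show ?thesis
    by (auto simp: top_bidual_def top_dual_add top_dual_cmult)
qed

section \<open>Arens adjoints\<close>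

lemma normed_space_over_times: "normed_space_over ((*) :: 'k::real_normed_field \<Rightarrow> 'k \<Rightarrow> 'k)"
  by unfold_locales (simp_all add: algebra_simps norm_mult scaleR_conv_of_real)

text \<open>Scalar-valued bilinear maps, obtained by composing an action with a functional. In this
  form the two orders of extension to the biduals become symmetric.\<close>

locale bounded_form_over = bounded_bilinear_over scaleX scaleY "(*)" m
  for scaleX :: "'k::real_normed_field \<Rightarrow> 'x::real_normed_vector \<Rightarrow> 'x"
    and scaleY :: "'k \<Rightarrow> 'y::real_normed_vector \<Rightarrow> 'y"
    and m :: "'x \<Rightarrow> 'y \<Rightarrow> 'k"
begin

lemma flip_form: "bounded_form_over scaleY scaleX (\<lambda>y x. m x y)"
  by (intro bounded_form_over.intro bounded_bilinear_over.intro bounded_bilinear_over_axioms.intro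
      Y.normed_space_over_axioms X.normed_space_over_axioms Z.normed_space_over_axioms flip
      scale_left scale_right)

lemma slice_in_top_dual: "m x \<in> top_dual scaleY"
  unfolding top_dual_def using bounded_linear_right scale_right by auto

lemma slice_in_top_dual': "(\<lambda>x. m x y) \<in> top_dual scaleX"
  unfolding top_dual_def using bounded_linear_left scale_left by auto

lemma bidual_slice_in_top_dual:
  assumes F: "F \<in> top_bidual scaleY"
  shows "(\<lambda>x. F (m x)) \<in> top_dual scaleX"
proof -
  obtain K where K: "K \<ge> 0" "\<And>x y. norm (m x y) \<le> norm x * norm y * K"
    using nonneg_bounded by blast
  obtain C where C: "C \<ge> 0" "\<And>f K. f \<in> top_dual scaleY \<Longrightarrow> K \<ge> 0 \<Longrightarrow>
      (\<And>x. norm (f x) \<le> K * norm x) \<Longrightarrow> norm (F f) \<le> C * K"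
    using top_bidual_bound[OF F] by blast
  show ?thesis
  proof (rule top_dualI)
    show "F (m (x + y)) = F (m x) + F (m y)" for x y
      using top_bidual_add[OF F slice_in_top_dual slice_in_top_dual, of x y]
      by (simp add: add_left[abs_def])
    show "F (m (scaleX c x)) = c * F (m x)" for c x
      using top_bidual_cmult[OF F slice_in_top_dual, of c x] by (simp add: scale_left[abs_def])
    show "norm (F (m x)) \<le> C * K * norm x" for x
      using C(2)[OF slice_in_top_dual[of x], of "K * norm x"] K by (simp add: ac_simps)
  qed (rule X.normed_space_over_axioms)
qed

end

lemma (in bounded_bilinear_over) dual_comp_form:
  assumes "f \<in> top_dual scaleZ"
  shows "bounded_form_over scaleX scaleY (\<lambda>x y. f (m x y))"
proof -
  interpret f: bounded_linear f
    using assms by (rule top_dual_bounded_linear)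
  obtain K where K: "K \<ge> 0" "\<And>x y. norm (m x y) \<le> norm x * norm y * K"
    using nonneg_bounded by blast
  obtain C where C: "C \<ge> 0" "\<And>z. norm (f z) \<le> norm z * C"
    using f.nonneg_bounded by blast
  have "norm (f (m x y)) \<le> norm x * norm y * (K * C)" for x y
    using C(2)[of "m x y"] mult_right_mono[OF K(2)[of x y] C(1)] by (simp add: mult.assoc)
  then have "bounded_bilinear (\<lambda>x y. f (m x y))"
    by unfold_locales (auto simp: add_left add_right scaleR_left scaleR_right f.add f.scaleR)
  then show ?thesis
    using top_dual_scl[OF assms] scale_left scale_right
    by (intro bounded_form_over.intro bounded_bilinear_over.intro bounded_bilinear_over_axioms.intro
        Y.normed_space_over_axioms X.normed_space_over_axioms normed_space_over_times) auto
qed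

text \<open>Needed for continuity into \<open>weak_star_bidual\<close>, a subspace topology whose
  points must lie in the bidual.\<close>

lemma (in bounded_bilinear_over) adj3_in_top_bidual:
  assumes x: "x'' \<in> top_bidual scaleX" and y: "y'' \<in> top_bidual scaleY"
  shows "adj3 scaleZ m x'' y'' \<in> top_bidual scaleZ"
proof -
  have adj1: "adj1 m f x \<in> top_dual scaleY" if "f \<in> top_dual scaleZ" for f x
    unfolding adj1_def using bounded_form_over.slice_in_top_dual[OF dual_comp_form[OF that]] .
  have adj2: "adj2 m y'' f \<in> top_dual scaleX" if "f \<in> top_dual scaleZ" for f
    using bounded_form_over.bidual_slice_in_top_dual[OF dual_comp_form[OF that] y]
    by (simp add: adj2_def[abs_def] adj1_def)
  have lin: "adj2 m y'' (\<lambda>z. f z + c * g z) = (\<lambda>x. adj2 m y'' f x + c * adj2 m y'' g x)"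
    if "f \<in> top_dual scaleZ" "g \<in> top_dual scaleZ" for f g c
    using top_bidual_comb[OF y adj1[OF that(1)] adj1[OF that(2)], of _ c]
    by (simp add: adj2_def adj1_def)
  have add: "x'' (adj2 m y'' (\<lambda>z. f z + g z)) = x'' (adj2 m y'' f) + x'' (adj2 m y'' g)"
    if "f \<in> top_dual scaleZ" "g \<in> top_dual scaleZ" for f g
    using top_bidual_add[OF x adj2[OF that(1)] adj2[OF that(2)]] lin[OF that, of 1] by simp
  have adj2_0: "adj2 m y'' (\<lambda>_. 0) = (\<lambda>_. 0)"
    by (simp add: adj2_def adj1_def top_bidual_zero[OF y])
  have scl: "x'' (adj2 m y'' (\<lambda>z. c * f z)) = c * x'' (adj2 m y'' f)" if "f \<in> top_dual scaleZ" for f c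
    using top_bidual_cmult[OF x adj2[OF that], of c] lin[OF top_dual_zero that, of c]
    by (simp add: adj2_0)
  obtain K where K: "K \<ge> 0" "\<And>x y. norm (m x y) \<le> norm x * norm y * K"
    using nonneg_bounded by blast
  obtain C where C: "C \<ge> 0" "\<And>f K. f \<in> top_dual scaleX \<Longrightarrow> K \<ge> 0 \<Longrightarrow>
      (\<And>x. norm (f x) \<le> K * norm x) \<Longrightarrow> norm (x'' f) \<le> C * K"
    using top_bidual_bound[OF x] by blast
  obtain B where B: "B \<ge> 0" "\<And>f K. f \<in> top_dual scaleY \<Longrightarrow> K \<ge> 0 \<Longrightarrow>
      (\<And>x. norm (f x) \<le> K * norm x) \<Longrightarrow> norm (y'' f) \<le> B * K"
    using top_bidual_bound[OF y] by blast
  have "norm (x'' (adj2 m y'' f)) \<le> (C * B * K) * onorm f" if f: "f \<in> top_dual scaleZ" for f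
  proof -
    have n: "onorm f \<ge> 0" and on: "norm (f z) \<le> onorm f * norm z" for z
      using onorm_pos_le onorm top_dual_bounded_linear[OF f] by blast+
    have "norm (adj1 m f x y) \<le> (onorm f * K * norm x) * norm y" for x y
      unfolding adj1_def using on[of "m x y"] mult_left_mono[OF K(2)[of x y] n]
      by (simp add: ac_simps)
    then have "norm (adj2 m y'' f x) \<le> B * (onorm f * K * norm x)" for x
      unfolding adj2_def using n K by (intro B(2) adj1 f) auto
    then have "norm (x'' (adj2 m y'' f)) \<le> C * (B * onorm f * K)"
      using n K B(1) by (intro C(2) adj2 f) (auto simp: ac_simps)
    then show ?thesis
      by (simp add: ac_simps)
  qed
  then show ?thesis
    unfolding top_bidual_def adj3_def
    using add scl by (auto simp: top_dual_add top_dual_cmult)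
qed

text \<open>Weak* continuity is tested at each \<open>f\<close> separately, and there the map is
  evaluation at a fixed \<open>g\<close> in the dual, a coordinate projection.\<close>

lemma (in bounded_bilinear_over) topological_centreI:
  assumes x: "x'' \<in> top_bidual scaleX"
    and rep: "\<And>f. f \<in> top_dual scaleZ \<Longrightarrow>
      \<exists>g\<in>top_dual scaleY. \<forall>y''\<in>top_bidual scaleY. x'' (\<lambda>x. y'' (\<lambda>y. f (m x y))) = y'' g"
  shows "x'' \<in> topological_centre scaleX scaleY scaleZ m"
proof -
  have top: "topspace (weak_star_bidual scaleY) \<subseteq> top_bidual scaleY"
    by (simp add: weak_star_bidual_def)
  have "continuous_map (weak_star_bidual scaleY) euclidean (\<lambda>y''. adj3 scaleZ m x'' y'' f)"
    if f: "f \<in> top_dual scaleZ" for f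
  proof -
    obtain g where g: "g \<in> top_dual scaleY"
        "\<And>y''. y'' \<in> top_bidual scaleY \<Longrightarrow> x'' (\<lambda>x. y'' (\<lambda>y. f (m x y))) = y'' g"
      using rep[OF f] by blast
    have "continuous_map (weak_star_bidual scaleY) euclidean (\<lambda>y''. y'' g)"
      unfolding weak_star_bidual_def
      by (intro continuous_map_from_subtopology continuous_map_product_projection g(1))
    then show ?thesis
      by (rule continuous_map_eq) (use g(2) f top in \<open>auto simp: adj3_def adj2_def adj1_def\<close>)
  qed
  then have "continuous_map (weak_star_bidual scaleY) (weak_star_bidual scaleZ) (adj3 scaleZ m x'')"
    unfolding weak_star_bidual_def[of scaleZ] continuous_map_in_subtopology continuous_map_componentwise
    using top adj3_in_top_bidual[OF x] by (auto simp: adj3_def)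
  then show ?thesis
    using x by (simp add: topological_centre_def)
qed

text \<open>Bounded sequences are built with \<open>m (X n) (Y k) = \<beta>\<close> and
  \<open>m (X k) (Y n) = \<alpha>\<close> for \<open>k < n\<close>. Let \<open>F\<close> be a limit
  of the functionals \<open>m (X n)\<close> and \<open>G\<close> a limit of the evaluations at
  \<open>Y n\<close>. A \<open>y\<close> that agrees with \<open>G\<close> on \<open>F\<close> and
  on all \<open>m (X k)\<close> gives \<open>F y = \<beta>\<close> and
  \<open>F y = \<alpha>\<close>.\<close>

theorem bidual_extensions_agree:
  fixes scaleX :: "'k::{real_normed_field,heine_borel} \<Rightarrow> 'x::real_normed_vector \<Rightarrow> 'x"
    and scaleY :: "'k \<Rightarrow> 'y::real_normed_vector \<Rightarrow> 'y"
  assumes form: "bounded_form_over scaleX scaleY m"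
    and x'': "x'' \<in> top_bidual scaleX" and y'': "y'' \<in> top_bidual scaleY"
    and agree: "\<And>z'' f. z'' \<in> top_bidual scaleY \<Longrightarrow> (\<And>n::nat. f n \<in> top_dual scaleY) \<Longrightarrow>
      \<exists>y. \<forall>n. z'' (f n) = f n y"
  shows "x'' (\<lambda>x. y'' (m x)) = y'' (\<lambda>y. x'' (\<lambda>x. m x y))"
proof -
  interpret bounded_form_over scaleX scaleY m
    by (rule form)
  define \<alpha> where "\<alpha> = x'' (\<lambda>x. y'' (m x))"
  define \<beta> where "\<beta> = y'' (\<lambda>y. x'' (\<lambda>x. m x y))"
  define g where "g = (\<lambda>x. y'' (m x))"
  define h where "h = (\<lambda>y. x'' (\<lambda>x. m x y))"
  have g: "g \<in> top_dual scaleX"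
    unfolding g_def using y'' by (rule bidual_slice_in_top_dual)
  have h: "h \<in> top_dual scaleY"
    unfolding h_def using x'' by (rule bounded_form_over.bidual_slice_in_top_dual[OF flip_form])
  obtain C where C: "\<And>I. finite I \<Longrightarrow> I \<subseteq> top_dual scaleX \<Longrightarrow> \<exists>v. norm v \<le> C \<and> (\<forall>f\<in>I. f v = x'' f)"
    using X.bidual_agrees_on_finite[OF x''] by blast
  obtain B where B: "\<And>I. finite I \<Longrightarrow> I \<subseteq> top_dual scaleY \<Longrightarrow> \<exists>v. norm v \<le> B \<and> (\<forall>f\<in>I. f v = y'' f)"
    using Y.bidual_agrees_on_finite[OF y''] by blast
  \<comment> \<open>The conditions on \<open>g\<close> and \<open>h\<close> keep the recursion
    going: they say that the bidual elements take the values \<alpha> and \<beta> on the slices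
    which later members must match.\<close>
  define P where "P = (\<lambda>s (n::nat) (x, y). norm x \<le> C \<and> norm y \<le> B \<and> g x = \<alpha> \<and> h y = \<beta> \<and>
    m x y = \<alpha> \<and> (\<forall>k<n. m x (snd (s k)) = \<beta> \<and> m (fst (s k)) y = \<alpha>))"
  have "\<exists>s. \<forall>n. P s n (s n)"
  proof (rule dependent_wellorder_choice)
    show "P s n r = P t n r" if "\<And>k. k < n \<Longrightarrow> s k = t k" for r s t n
      using that by (auto simp: P_def split: prod.splits)
  next
    fix n s
    assume s: "P s k (s k)" if "k < n" for k
    have s': "g (fst (s k)) = \<alpha>" "h (snd (s k)) = \<beta>" if "k < n" for k
      using s[OF that] by (auto simp: P_def split: prod.splits)
    obtain x where x: "norm x \<le> C" "g x = x'' g"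
        "\<And>k. k < n \<Longrightarrow> m x (snd (s k)) = x'' (\<lambda>x. m x (snd (s k)))"
      using C[of "insert g ((\<lambda>k x. m x (snd (s k))) ` {..<n})"] g slice_in_top_dual' by auto
    \<comment> \<open>\<open>y\<close> is chosen after \<open>x\<close>, so that \<open>m x\<close>
      can be among the finitely many functionals to match.\<close>
    obtain y where y: "norm y \<le> B" "h y = y'' h" "m x y = y'' (m x)"
        "\<And>k. k < n \<Longrightarrow> m (fst (s k)) y = y'' (m (fst (s k)))"
      using B[of "insert h (insert (m x) ((\<lambda>k. m (fst (s k))) ` {..<n}))"] h slice_in_top_dual by auto
    have "P s n (x, y)"
      using x y s' by (auto simp: P_def g_def h_def \<alpha>_def \<beta>_def)
    then show "\<exists>r. P s n r" ..
  qed
  then obtain s where s: "\<And>n. P s n (s n)"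
    by blast
  define X where "X n = fst (s n)" for n
  define Y where "Y n = snd (s n)" for n
  have XY: "norm (X n) \<le> C" "norm (Y n) \<le> B" "m (X n) (Y n) = \<alpha>" for n
    using s[of n] by (auto simp: P_def X_def Y_def split: prod.splits)
  have XY_less: "m (X n) (Y k) = \<beta>" "m (X k) (Y n) = \<alpha>" if "k < n" for k n
    using s[of n] that by (auto simp: P_def X_def Y_def split: prod.splits)
  obtain K where K: "K \<ge> 0" "\<And>x y. norm (m x y) \<le> norm x * norm y * K"
    using nonneg_bounded by blast
  have mX: "norm (m (X n) y) \<le> (C * K) * norm y" for n y
    using K(2)[of "X n" y] mult_right_mono[OF XY(1)[of n], of "norm y * K"] K(1)
    by (simp add: ac_simps)
  obtain U where U: "U \<le> sequentially" "U \<noteq> bot"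
      "\<And>h B. \<forall>\<^sub>F i in sequentially. norm (h i :: 'k) \<le> B \<Longrightarrow> \<exists>l. (h \<longlongrightarrow> l) U"
    using finer_filter_bounded_convergent[OF trivial_limit_sequentially] by blast
  have "\<exists>l. ((\<lambda>n. m (X n) y) \<longlongrightarrow> l) U" for y
    using mX by (intro U(3) always_eventually) auto
  then obtain F where F: "\<And>y. ((\<lambda>n. m (X n) y) \<longlongrightarrow> F y) U"
    by metis
  have F_dual: "F \<in> top_dual scaleY"
    by (rule pointwise_limit_in_top_dual[where f = "\<lambda>n. m (X n)",
          OF Y.normed_space_over_axioms U(2) slice_in_top_dual mX F])
  have "\<exists>l. ((\<lambda>n. f (Y n)) \<longlongrightarrow> l) U" if f: "f \<in> top_dual scaleY" for f
  proof (intro U(3) always_eventually allI)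
    fix n
    show "norm (f (Y n)) \<le> onorm f * B"
      using onorm[OF top_dual_bounded_linear[OF f], of "Y n"] XY(2)
        onorm_pos_le[OF top_dual_bounded_linear[OF f]] by (meson mult_left_mono order_trans)
  qed
  then obtain G where G: "\<And>f. f \<in> top_dual scaleY \<Longrightarrow> ((\<lambda>n. f (Y n)) \<longlongrightarrow> G f) U"
    by metis
  have G_bidual: "restrict G (top_dual scaleY) \<in> top_bidual scaleY"
    using XY(2) by (intro eval_limit_in_top_bidual[OF U(2) _ G] always_eventually) auto
  have U_gt: "\<forall>\<^sub>F n in U. n > k" for k
    by (rule filter_leD[OF U(1) eventually_gt_at_top])
  have G_X: "G (m (X k)) = \<alpha>" for k
    by (rule tendsto_unique[OF U(2) G[OF slice_in_top_dual]], rule tendsto_eventually)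
      (auto intro: eventually_mono[OF U_gt[of k]] simp: XY_less)
  have "F (Y k) = \<beta>" for k
    by (rule tendsto_unique[OF U(2) F], rule tendsto_eventually)
      (auto intro: eventually_mono[OF U_gt[of k]] simp: XY_less)
  then have G_F: "G F = \<beta>"
    using G[OF F_dual] U(2) by (simp add: tendsto_const_iff)
  \<comment> \<open>One sequence contains the limit \<open>F\<close> and all \<open>m (X k)\<close>,
    so a single \<open>y\<close> serves for all of them.\<close>
  define f where "f n = (case n of 0 \<Rightarrow> F | Suc k \<Rightarrow> m (X k))" for n
  have f: "f n \<in> top_dual scaleY" for n
    by (cases n) (simp_all add: f_def F_dual slice_in_top_dual)
  then obtain y where y: "\<And>n. G (f n) = f n y"
    using agree[OF G_bidual, of f] by auto
  have "F y = \<beta>"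
    using y[of 0] G_F by (simp add: f_def)
  moreover have "m (X k) y = \<alpha>" for k
    using y[of "Suc k"] G_X by (simp add: f_def)
  then have "F y = \<alpha>"
    using F[of y] U(2) by (simp add: tendsto_const_iff)
  ultimately show ?thesis
    by (simp add: \<alpha>_def \<beta>_def)
qed

section \<open>Cohen factorization\<close>

text \<open>The estimate is allowed to start at \<open>N\<close> because in Cohen's construction the
  solution for the \<open>j\<close>-th vector is controlled only from step \<open>j\<close>
  on.\<close>

lemma Cauchy_of_geometric_steps:
  fixes x :: "nat \<Rightarrow> 'v::real_normed_vector"
  assumes \<rho>: "0 \<le> \<rho>" "\<rho> < 1" and step: "\<And>n. n \<ge> N \<Longrightarrow> norm (x (Suc n) - x n) \<le> C * \<rho> ^ n"
  shows "Cauchy x"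
proof -
  have le: "norm (x m - x n) \<le> C * (\<rho> ^ n - \<rho> ^ m) / (1 - \<rho>)" if "n \<ge> N" "m \<ge> n" for n m
    using \<open>m \<ge> n\<close>
  proof (induction rule: dec_induct)
    case (step m)
    have "norm (x (Suc m) - x n) \<le> norm (x (Suc m) - x m) + norm (x m - x n)"
      using norm_triangle_ineq[of "x (Suc m) - x m" "x m - x n"] by simp
    also have "\<dots> \<le> C * \<rho> ^ m + C * (\<rho> ^ n - \<rho> ^ m) / (1 - \<rho>)"
      using step that assms(3)[of m] by (intro add_mono) auto
    also have "\<dots> = C * (\<rho> ^ n - \<rho> ^ Suc m) / (1 - \<rho>)"
      using \<rho> by (simp add: field_simps)
    finally show ?case .
  qed simp
  have "C * \<rho> ^ N \<ge> 0"
    using step[of N] norm_ge_zero order_trans by blast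
  then have C: "C * \<rho> ^ m \<ge> 0" if "m \<ge> N" for m
    using step[OF that] norm_ge_zero order_trans by blast
  have le': "norm (x m - x n) \<le> C * \<rho> ^ n / (1 - \<rho>)" if "n \<ge> N" "m \<ge> n" for n m
    using le[OF that] C[of m] that \<rho>
    by (smt (verit) divide_right_mono le_trans right_diff_distrib)
  have "(\<lambda>n. C * \<rho> ^ n / (1 - \<rho>)) \<longlonglongrightarrow> C * 0 / (1 - \<rho>)"
    using \<rho> by (intro tendsto_intros LIMSEQ_power_zero) auto
  then have lim: "(\<lambda>n. C * \<rho> ^ n / (1 - \<rho>)) \<longlonglongrightarrow> 0"
    by simp
  show ?thesis
    unfolding Cauchy_altdef2
  proof (intro allI impI)
    fix e :: real
    assume "e > 0"
    then have "\<forall>\<^sub>F n in sequentially. C * \<rho> ^ n / (1 - \<rho>) < e"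
      using lim by (rule order_tendstoD(2)[rotated])
    then have "\<forall>\<^sub>F n in sequentially. C * \<rho> ^ n / (1 - \<rho>) < e \<and> n \<ge> N"
      using eventually_ge_at_top[of N] by eventually_elim auto
    then obtain n where "C * \<rho> ^ n / (1 - \<rho>) < e" "n \<ge> N"
      by (auto simp: eventually_sequentially)
    then show "\<exists>n. \<forall>m\<ge>n. dist (x m) (x n) < e"
      using le' by (intro exI[of _ n]) (auto simp: dist_norm intro: le_less_trans)
  qed
qed

text \<open>Solving \<open>b x + d x = y\<close> means finding a fixed point of
  \<open>x \<mapsto> b\<^sup>-\<^sup>1 (y - d x)\<close>, a contraction with constant 1/2 on the
  complete set \<open>S\<close>. The lower bound for \<open>b\<close> is at worst halved.\<close>

lemma bij_betw_perturbation:
  fixes b d :: "'v::real_normed_vector \<Rightarrow> 'v"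
  assumes S: "subspace S" "complete S" and lin: "linear b" "linear d"
    and b: "bij_betw b S S" "\<And>x. x \<in> S \<Longrightarrow> \<kappa> * norm x \<le> norm (b x)" and "\<kappa> > 0"
    and d: "\<And>x. x \<in> S \<Longrightarrow> d x \<in> S" "\<And>x. x \<in> S \<Longrightarrow> norm (d x) \<le> \<kappa> / 2 * norm x"
  shows "bij_betw (\<lambda>x. b x + d x) S S" and "\<And>x. x \<in> S \<Longrightarrow> \<kappa> / 2 * norm x \<le> norm (b x + d x)"
proof -
  show lower: "\<kappa> / 2 * norm x \<le> norm (b x + d x)" if "x \<in> S" for x
    using b(2)[OF that] d(2)[OF that] norm_diff_ineq[of "b x" "d x"] by simp
  have bS: "b x \<in> S" if "x \<in> S" for x
    using b(1) that by (auto simp: bij_betw_def)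
  have "inj_on (\<lambda>x. b x + d x) S"
  proof (rule inj_onI)
    fix x y
    assume xy: "x \<in> S" "y \<in> S" "b x + d x = b y + d y"
    then have "b (x - y) + d (x - y) = 0"
      by (simp add: linear_diff[OF lin(1)] linear_diff[OF lin(2)] algebra_simps)
    then have "\<kappa> / 2 * norm (x - y) \<le> 0"
      using lower[OF subspace_diff[OF S(1) xy(1,2)]] by simp
    then show "x = y"
      using \<open>\<kappa> > 0\<close> by (simp add: mult_le_0_iff)
  qed
  moreover have "\<exists>x\<in>S. b x + d x = y" if y: "y \<in> S" for y
  proof -
    define g where "g = inv_into S b"
    have g: "g z \<in> S" "b (g z) = z" if "z \<in> S" for z
      using b(1) that by (auto simp: g_def bij_betw_def inv_into_into f_inv_into_f)
    have ydS: "y - d x \<in> S" if "x \<in> S" for x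
      using S(1) y d(1) that by (simp add: subspace_diff)
    have "\<exists>!x\<in>S. g (y - d x) = x"
    proof (rule Banach_fix[of S "1/2"])
      show "S \<noteq> {}"
        using y by blast
      show "(\<lambda>x. g (y - d x)) ` S \<subseteq> S"
        using g ydS by auto
      show "dist (g (y - d x)) (g (y - d z)) \<le> 1 / 2 * dist x z" if xz: "x \<in> S" "z \<in> S" for x z
      proof -
        have "\<kappa> * norm (g (y - d x) - g (y - d z)) \<le> norm (b (g (y - d x) - g (y - d z)))"
          using g ydS xz S(1) by (intro b(2) subspace_diff) auto
        also have "b (g (y - d x) - g (y - d z)) = d (z - x)"
          using g ydS xz by (simp add: linear_diff[OF lin(1)] linear_diff[OF lin(2)])
        also have "norm (d (z - x)) \<le> \<kappa> / 2 * norm (z - x)"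
          using xz S(1) by (intro d(2) subspace_diff)
        finally show ?thesis
          using \<open>\<kappa> > 0\<close> by (simp add: dist_norm norm_minus_commute)
      qed
    qed (use S in auto)
    then obtain x where x: "x \<in> S" "g (y - d x) = x"
      by blast
    then have "b x = y - d x"
      using g(2)[OF ydS[OF x(1)]] by simp
    then show ?thesis
      using x by (intro bexI[of _ x]) auto
  qed
  moreover have "b x + d x \<in> S" if "x \<in> S" for x
    using S(1) bS d(1) that by (simp add: subspace_add)
  ultimately show "bij_betw (\<lambda>x. b x + d x) S S"
    by (auto simp: bij_betw_def image_iff)
qed

text \<open>Cohen's factorization for countably many vectors at once: the operators
  \<open>T\<^sub>n = (1 - c)\<^sup>n + \<Sum>\<^sub>k\<^sub><\<^sub>n c (1 - c)\<^sup>k e\<^sub>k\<close> converge to the action of an element of the algebra,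
  while every \<open>T\<^sub>n\<^sup>-\<^sup>1 v\<^sub>j\<close> converges because the \<open>e\<^sub>k\<close> are chosen one after the other.\<close>

theorem Cohen_factorization_sequence:
  fixes act :: "'a::{real_normed_algebra,banach} \<Rightarrow> 'v::real_normed_vector \<Rightarrow> 'v"
  assumes E: "E \<noteq> bot" "\<forall>\<^sub>F e in E. norm e \<le> M" "\<And>a. ((\<lambda>e. e * a) \<longlongrightarrow> a) E"
    and act: "bounded_bilinear act" "\<And>a a' x. act (a * a') x = act a (act a' x)"
    and S: "subspace S" "complete S" "\<And>a x. x \<in> S \<Longrightarrow> act a x \<in> S"
      "\<And>x. x \<in> S \<Longrightarrow> ((\<lambda>e. act e x) \<longlongrightarrow> x) E"
    and v: "\<And>n::nat. v n \<in> S"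
  shows "\<exists>a. \<forall>n. \<exists>w\<in>S. act a w = v n"
proof -
  interpret act: bounded_bilinear act
    by fact
  obtain K where K: "K > 0" "\<And>a x. norm (act a x) \<le> norm a * norm x * K"
    using act.pos_bounded by blast
  define L where "L = max M 1"
  have L: "L > 0" "\<forall>\<^sub>F e in E. norm e \<le> L"
    using E(2) by (auto simp: L_def elim: eventually_mono)
  \<comment> \<open>Chosen so that \<open>c * (L * K) = (1 - c) / 2\<close>: then \<open>c e\<close>
    perturbs multiplication by \<open>1 - c\<close> by at most half its lower bound.\<close>
  define c where "c = 1 / (2 * L * K + 1)"
  have LK: "L * K > 0"
    using L K by simp
  have c: "0 < c" "c < 1" and cLK: "c * (L * K) = (1 - c) / 2"
    using LK by (simp_all add: c_def field_simps)
  \<comment> \<open>Each step multiplies the lower bound by \<open>1 - c\<close> and halves it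
    twice, once for the factor \<open>(1 - c) + c e\<close> and once for an error term.\<close>
  define r where "r = (1 - c) / 4"
  have "r > 0"
    using c by (simp add: r_def)
  define T where "T n \<alpha> x = (1 - c) ^ n *\<^sub>R x + act \<alpha> x" for n \<alpha> x
  have lin: "linear (T n \<alpha>)" for n \<alpha>
    by (intro linearI) (simp_all add: T_def act.add_right act.scaleR_right scaleR_add_right)
  have linact: "linear (\<lambda>x. s *\<^sub>R act \<alpha> x)" for s \<alpha>
    by (intro linearI) (simp_all add: act.add_right act.scaleR_right scaleR_add_right)
  define P where "P n \<alpha> \<longleftrightarrow> bij_betw (T n \<alpha>) S S \<and> (\<forall>x\<in>S. r ^ n * norm x \<le> norm (T n \<alpha> x))" for n \<alpha>
  \<comment> \<open>The bound anticipates division by the lower bound \<open>r ^ Suc n\<close> of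
    the next operator, after which the solutions for \<open>v 0, ..., v n\<close> move by at most
    \<open>(1 / 2) ^ n\<close>.\<close>
  define Q where "Q n \<alpha> \<alpha>' \<longleftrightarrow> (\<exists>e. norm e \<le> L \<and> \<alpha>' = \<alpha> + (c * (1 - c) ^ n) *\<^sub>R e \<and>
    (\<forall>j\<le>n. \<forall>w\<in>S. T n \<alpha> w = v j \<longrightarrow>
      c * (1 - c) ^ n * norm (w - act e w) \<le> r ^ Suc n * (1 / 2) ^ n))" for n \<alpha> \<alpha>'
  have "\<exists>\<alpha>. \<forall>n. P n (\<alpha> n) \<and> Q n (\<alpha> n) (\<alpha> (Suc n))"
  proof (rule dependent_nat_choice)
    have "P 0 0"
      by (simp add: P_def T_def act.zero_left bij_betw_def inj_on_def)
    then show "\<exists>\<alpha>. P 0 \<alpha>" ..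
  next
    fix \<alpha> n
    assume P: "P n \<alpha>"
    have bij: "bij_betw (T n \<alpha>) S S" and low: "\<And>x. x \<in> S \<Longrightarrow> r ^ n * norm x \<le> norm (T n \<alpha> x)"
      using P by (auto simp: P_def)
    define w where "w j = inv_into S (T n \<alpha>) (v j)" for j
    have w: "w j \<in> S" for j
      using bij v by (simp add: w_def bij_betw_def inv_into_into)
    have w_unique: "x = w j" if "x \<in> S" "T n \<alpha> x = v j" for x j
      using bij that by (metis bij_betw_imp_inj_on inv_into_f_f w_def)
    have "\<forall>\<^sub>F e in E. norm e \<le> L \<and> norm (\<alpha> - e * \<alpha>) < r ^ Suc n / (c * K) \<and>
        (\<forall>j\<in>{..n}. norm (w j - act e (w j)) < r ^ Suc n * (1 / 2) ^ n / (c * (1 - c) ^ n))"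
    proof (intro eventually_conj L(2) eventually_ball_finite ballI)
      have "0 < r ^ Suc n / (c * K)"
        using \<open>r > 0\<close> c K by simp
      then show "\<forall>\<^sub>F e in E. norm (\<alpha> - e * \<alpha>) < r ^ Suc n / (c * K)"
        using tendstoD[OF E(3)[of \<alpha>]] by (simp add: dist_norm norm_minus_commute)
      have "0 < r ^ Suc n * (1 / 2) ^ n / (c * (1 - c) ^ n)"
        using \<open>r > 0\<close> c by simp
      then show "\<forall>\<^sub>F e in E. norm (w j - act e (w j)) < r ^ Suc n * (1 / 2) ^ n / (c * (1 - c) ^ n)" for j
        using tendstoD[OF S(4)[OF w[of j]]] by (simp add: dist_norm norm_minus_commute)
    qed simp
    then obtain e where e: "norm e \<le> L" "norm (\<alpha> - e * \<alpha>) < r ^ Suc n / (c * K)"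
        "\<And>j. j \<le> n \<Longrightarrow> norm (w j - act e (w j)) < r ^ Suc n * (1 / 2) ^ n / (c * (1 - c) ^ n)"
      using eventually_happens'[OF E(1)] by blast
    define \<alpha>' where "\<alpha>' = \<alpha> + (c * (1 - c) ^ n) *\<^sub>R e"
    have q: "bij_betw (\<lambda>x. (1 - c) *\<^sub>R x + c *\<^sub>R act e x) S S"
        "\<And>x. x \<in> S \<Longrightarrow> (1 - c) / 2 * norm x \<le> norm ((1 - c) *\<^sub>R x + c *\<^sub>R act e x)"
    proof (rule_tac [!] bij_betw_perturbation[OF S(1,2) _ linact])
      show "bij_betw ((*\<^sub>R) (1 - c)) S S"
        using c S(1) by (intro bij_betw_byWitness[where f' = "(*\<^sub>R) (1 / (1 - c))"])
          (auto intro: subspace_scale)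
      then show "bij_betw ((*\<^sub>R) (1 - c)) S S" .
      show bound: "norm (c *\<^sub>R act e x) \<le> (1 - c) / 2 * norm x" if "x \<in> S" for x
      proof -
        have "norm (act e x) \<le> L * norm x * K"
          using K(2)[of e x] e(1) K(1) by (meson less_imp_le mult_right_mono norm_ge_zero order_trans)
        then have "norm (c *\<^sub>R act e x) \<le> c * (L * norm x * K)"
          using c by simp
        also have "\<dots> = c * (L * K) * norm x"
          by simp
        finally show ?thesis
          by (simp only: cLK)
      qed
      then show "norm (c *\<^sub>R act e x) \<le> (1 - c) / 2 * norm x" if "x \<in> S" for x
        using that .
    qed (use c S in \<open>auto intro: linear_scale_self subspace_scale\<close>)
    have qT: "bij_betw (\<lambda>x. (1 - c) *\<^sub>R T n \<alpha> x + c *\<^sub>R act e (T n \<alpha> x)) S S"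
      using bij_betw_trans[OF bij q(1)] by (simp add: o_def)
    have qT_low: "2 * r ^ Suc n * norm x \<le> norm ((1 - c) *\<^sub>R T n \<alpha> x + c *\<^sub>R act e (T n \<alpha> x))"
      if "x \<in> S" for x
    proof -
      have "2 * r ^ Suc n * norm x = (1 - c) / 2 * (r ^ n * norm x)"
        by (simp add: r_def)
      also have "\<dots> \<le> (1 - c) / 2 * norm (T n \<alpha> x)"
        using low[OF that] c by (intro mult_left_mono) auto
      also have "\<dots> \<le> norm ((1 - c) *\<^sub>R T n \<alpha> x + c *\<^sub>R act e (T n \<alpha> x))"
        using bij that by (intro q(2)) (auto simp: bij_betw_def)
      finally show ?thesis .
    qed
    have qT_lin: "linear (\<lambda>x. (1 - c) *\<^sub>R T n \<alpha> x + c *\<^sub>R act e (T n \<alpha> x))"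
      by (intro linearI) (simp_all add: linear_add[OF lin] linear_cmul[OF lin] act.add_right
          act.scaleR_right algebra_simps)
    have d: "norm (c *\<^sub>R act (\<alpha> - e * \<alpha>) x) \<le> 2 * r ^ Suc n / 2 * norm x" for x
    proof -
      have "norm (c *\<^sub>R act (\<alpha> - e * \<alpha>) x) \<le> c * (norm (\<alpha> - e * \<alpha>) * norm x * K)"
        using K(2)[of "\<alpha> - e * \<alpha>" x] c by (simp add: mult.assoc)
      also have "\<dots> = (c * K) * norm (\<alpha> - e * \<alpha>) * norm x"
        by simp
      also have "\<dots> \<le> r ^ Suc n * norm x"
        using e(2) c K by (intro mult_right_mono) (auto simp: field_simps)
      finally show ?thesis by simp
    qed
    \<comment> \<open>\<open>T (Suc n)\<close> is a product of two invertible operators plus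
      \<open>c (\<alpha> - e \<alpha>)\<close>, which is small because \<open>e\<close> nearly fixes
      \<alpha>.\<close>
    have T': "T (Suc n) \<alpha>' = (\<lambda>x. ((1 - c) *\<^sub>R T n \<alpha> x + c *\<^sub>R act e (T n \<alpha> x)) +
        c *\<^sub>R act (\<alpha> - e * \<alpha>) x)"
      by (rule ext) (simp add: T_def \<alpha>'_def act.add_left act.add_right act.diff_left
          act.scaleR_left act.scaleR_right act(2) algebra_simps)
    have "P (Suc n) \<alpha>'"
      using bij_betw_perturbation[OF S(1,2) qT_lin linact qT qT_low _ _ d] \<open>r > 0\<close> S(1,3)
      unfolding P_def T' by (simp add: subspace_scale)
    moreover have "Q n \<alpha> \<alpha>'"
      unfolding Q_def
    proof (intro exI[of _ e] conjI e(1) allI impI ballI)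
      fix j x
      assume j: "j \<le> n" and x: "x \<in> S" "T n \<alpha> x = v j"
      have "norm (x - act e x) \<le> r ^ Suc n * (1 / 2) ^ n / (c * (1 - c) ^ n)"
        using e(3)[OF j] w_unique[OF x] by simp
      then show "c * (1 - c) ^ n * norm (x - act e x) \<le> r ^ Suc n * (1 / 2) ^ n"
        using c by (simp add: pos_le_divide_eq mult.commute)
    qed (simp add: \<alpha>'_def)
    ultimately show "\<exists>\<alpha>'. P (Suc n) \<alpha>' \<and> Q n \<alpha> \<alpha>'"
      by blast
  qed
  then obtain \<alpha> where P: "\<And>n. P n (\<alpha> n)" and Q: "\<And>n. Q n (\<alpha> n) (\<alpha> (Suc n))"
    by blast
  have "norm (\<alpha> (Suc n) - \<alpha> n) \<le> (c * L) * (1 - c) ^ n" for n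
    using Q[of n] c by (auto simp: Q_def mult.commute mult.left_commute intro!: mult_left_mono)
  then have "Cauchy \<alpha>"
    using c by (intro Cauchy_of_geometric_steps[of "1 - c" 0 \<alpha> "c * L"]) auto
  then obtain a where a: "\<alpha> \<longlonglongrightarrow> a"
    using Cauchy_convergent convergent_def by blast
  have "\<exists>w\<in>S. act a w = v j" for j
  proof -
    define w where "w n = inv_into S (T n (\<alpha> n)) (v j)" for n
    have w: "w n \<in> S" "T n (\<alpha> n) (w n) = v j" for n
      using P[of n] v by (auto simp: w_def P_def bij_betw_def inv_into_into f_inv_into_f)
    have "norm (w (Suc n) - w n) \<le> 1 * (1 / 2) ^ n" if jn: "j \<le> n" for n
    proof -
      obtain e where e: "\<alpha> (Suc n) = \<alpha> n + (c * (1 - c) ^ n) *\<^sub>R e"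
          "c * (1 - c) ^ n * norm (w n - act e (w n)) \<le> r ^ Suc n * (1 / 2) ^ n"
        using Q[of n] w jn unfolding Q_def by blast
      \<comment> \<open>The old solution nearly solves the new equation, with a defect controlled by
        \<open>w n - e w n\<close>.\<close>
      have "T (Suc n) (\<alpha> (Suc n)) (w n) = T n (\<alpha> n) (w n) - (c * (1 - c) ^ n) *\<^sub>R (w n - act e (w n))"
        by (simp add: T_def e(1) act.add_left act.scaleR_left algebra_simps)
      then have "T (Suc n) (\<alpha> (Suc n)) (w (Suc n) - w n) = (c * (1 - c) ^ n) *\<^sub>R (w n - act e (w n))"
        using w by (simp add: linear_diff[OF lin])
      then have "r ^ Suc n * norm (w (Suc n) - w n) \<le> norm ((c * (1 - c) ^ n) *\<^sub>R (w n - act e (w n)))"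
        using P[of "Suc n"] w S(1) by (metis P_def subspace_diff)
      also have "\<dots> \<le> r ^ Suc n * (1 / 2) ^ n"
        using e(2) c by simp
      finally show ?thesis
        using \<open>r > 0\<close> by simp
    qed
    then have "Cauchy w"
      by (intro Cauchy_of_geometric_steps[of "1 / 2" j w 1]) auto
    then obtain x where x: "x \<in> S" "w \<longlonglongrightarrow> x"
      using S(2) w(1) unfolding complete_def by blast
    have "(\<lambda>n. T n (\<alpha> n) (w n)) \<longlonglongrightarrow> 0 *\<^sub>R x + act a x"
      unfolding T_def using a x(2) c
      by (intro tendsto_add tendsto_scaleR LIMSEQ_power_zero act.tendsto) auto
    then have "act a x = v j"
      using w(2) by (simp add: LIMSEQ_const_iff)
    then show ?thesis
      using x(1) by blast
  qed
  then show ?thesis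
    by blast
qed

section \<open>Approximate identities and weak compactness\<close>

lemma (in normed_space_over) dual_separates_points:
  assumes "\<And>f. f \<in> top_dual scl \<Longrightarrow> f x = f y"
  shows "x = y"
proof -
  obtain f where "f \<in> top_dual scl" "infdist (x - y) {0} \<le> 2 * norm (f (x - y))"
    using dual_separates_subspace[of "{0}" "x - y"] by auto
  then show ?thesis
    using assms[of f] by (simp add: top_dual_diff_apply[of f scl] infdist_def)
qed

lemma (in bounded_bilinear_over) dual_comp_left:
  "f \<in> top_dual scaleZ \<Longrightarrow> (\<lambda>x. f (m x y)) \<in> top_dual scaleX"
  using bounded_form_over.slice_in_top_dual'[OF dual_comp_form] .

lemma (in bounded_bilinear_over) dual_comp_right:
  "f \<in> top_dual scaleZ \<Longrightarrow> (\<lambda>y. f (m x y)) \<in> top_dual scaleY"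
  using bounded_form_over.slice_in_top_dual[OF dual_comp_form] .

lemma Lww_property_representable:
  assumes "bounded_bilinear_over scaleB scaleA scaleB ract" "Lww_property scaleB ract"
    and F: "F \<in> top_bidual scaleB"
  shows "\<exists>b. \<forall>f\<in>top_dual scaleB. F (\<lambda>x. f (ract x a)) = f (ract b a)"
proof -
  interpret bounded_bilinear_over scaleB scaleA scaleB ract
    by fact
  show ?thesis
    using assms(2) dual_comp_left
    by (intro weak_star_weak_representable[OF X.normed_space_over_axioms _ _ F])
      (auto simp: Lww_property_def dual_lact_def)
qed

lemma Rww_property_representable:
  assumes "bounded_bilinear_over scaleA scaleB scaleB lact" "Rww_property scaleB lact"
    and F: "F \<in> top_bidual scaleB"
  shows "\<exists>b. \<forall>f\<in>top_dual scaleB. F (\<lambda>x. f (lact a x)) = f (lact a b)"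
proof -
  interpret bounded_bilinear_over scaleA scaleB scaleB lact
    by fact
  show ?thesis
    using assms(2) dual_comp_right
    by (intro weak_star_weak_representable[OF Y.normed_space_over_axioms _ _ F])
      (auto simp: Rww_property_def dual_ract_def)
qed

text \<open>Weak* compactness of balls in the bidual: a bounded net has a cluster point, reached
  along a finer filter.\<close>

lemma bidual_limit_exists:
  fixes scl :: "'k::{real_normed_field,heine_borel} \<Rightarrow> 'v::real_normed_vector \<Rightarrow> 'v"
  assumes "N \<noteq> bot" and v: "\<forall>\<^sub>F i in N. norm (v i) \<le> C"
  obtains U F where "U \<le> N" "U \<noteq> bot" "F \<in> top_bidual scl"
    "\<And>f. f \<in> top_dual scl \<Longrightarrow> ((\<lambda>i. f (v i)) \<longlongrightarrow> F f) U"
proof -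
  obtain U where U: "U \<le> N" "U \<noteq> bot"
      "\<And>h B. \<forall>\<^sub>F i in N. norm (h i :: 'k) \<le> B \<Longrightarrow> \<exists>l. (h \<longlongrightarrow> l) U"
    using finer_filter_bounded_convergent[OF assms(1)] by blast
  have "\<exists>l. ((\<lambda>i. f (v i)) \<longlongrightarrow> l) U" if f: "f \<in> top_dual scl" for f
  proof (rule U(3))
    have "norm (f (v i)) \<le> onorm f * C" if "norm (v i) \<le> C" for i
      using onorm[OF top_dual_bounded_linear[OF f], of "v i"] that
        onorm_pos_le[OF top_dual_bounded_linear[OF f]] by (meson mult_left_mono order_trans)
    then show "\<forall>\<^sub>F i in N. norm (f (v i)) \<le> onorm f * C"
      using v by (rule eventually_mono[rotated])
  qed
  then obtain G where G: "\<And>f. f \<in> top_dual scl \<Longrightarrow> ((\<lambda>i. f (v i)) \<longlongrightarrow> G f) U"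
    by metis
  show thesis
    using that[OF U(1,2) eval_limit_in_top_bidual[OF U(2) filter_leD[OF U(1) v] G]] G by simp
qed

text \<open>For a sequence in the approximate identity that is itself an approximate identity for its
  own members, weak compactness of right multiplication by a common left unit \<open>x\<close> forces the
  sequence to be eventually close to a single element; a filter that is not Cauchy would contain
  such a sequence with steps bounded away from zero.\<close>

theorem Lww_approximate_identity_cauchy:
  fixes scl :: "'k::{real_normed_field,heine_borel} \<Rightarrow> 'a::{real_normed_algebra,banach} \<Rightarrow> 'a"
  assumes alg: "banach_algebra_over scl" and bai: "bounded_approximate_identity (E :: 'a filter)"
    and Lww: "Lww_property scl ((*) :: 'a \<Rightarrow> 'a \<Rightarrow> 'a)"
  shows "cauchy_filter E"
proof (rule ccontr)
  assume "\<not> cauchy_filter E"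
  then obtain \<epsilon> where "\<epsilon> > 0"
      and "\<not> (\<exists>P. eventually P E \<and> (\<forall>x y. P x \<and> P y \<longrightarrow> dist x y < \<epsilon>))"
    unfolding cauchy_filter_metric by blast
  then have \<epsilon>: "\<epsilon> > 0" "\<And>P. eventually P E \<Longrightarrow> \<exists>x y. P x \<and> P y \<and> \<epsilon> \<le> dist x y"
    by (auto simp: not_less)
  interpret banach_algebra_over scl
    by (rule alg)
  note bil = bounded_bilinear_over_axioms
  have E: "E \<noteq> bot" and "\<exists>M. \<forall>\<^sub>F e in E. norm e \<le> M"
      and Ea: "((\<lambda>e. e * a) \<longlongrightarrow> a) E" and aE: "((\<lambda>e. a * e) \<longlongrightarrow> a) E" for a
    using bai by (auto simp: bounded_approximate_identity_def)
  then obtain M where M: "\<forall>\<^sub>F e in E. norm e \<le> M"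
    by blast
  \<comment> \<open>Each new member is a two-sided approximate unit for its predecessors, with error
    below \<open>1 / (n + 1)\<close>, and keeps its distance from the last one.\<close>
  define P where "P s n r \<longleftrightarrow> norm r \<le> M \<and>
    (\<forall>k\<in>{..<n}. dist (r * s k) (s k) < 1 / real (Suc n) \<and> dist (s k * r) (s k) < 1 / real (Suc n)) \<and>
    (n > 0 \<longrightarrow> \<epsilon> / 2 \<le> dist r (s (n - 1)))" for s n and r :: 'a
  have "\<exists>s. \<forall>n. P s n (s n)"
  proof (rule dependent_wellorder_choice)
    show "P s n r = P t n r" if "\<And>k. k < n \<Longrightarrow> s k = t k" for r n and s t :: "nat \<Rightarrow> 'a"
      using that by (auto simp: P_def)
  next
    fix n and s :: "nat \<Rightarrow> 'a"
    have "\<forall>\<^sub>F r in E. norm r \<le> M \<and> (\<forall>k\<in>{..<n}. dist (r * s k) (s k) < 1 / real (Suc n) \<and>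
        dist (s k * r) (s k) < 1 / real (Suc n))"
      by (intro eventually_conj M eventually_ball_finite ballI tendstoD[OF Ea] tendstoD[OF aE]) auto
    from \<epsilon>(2)[OF this] obtain x y where xy: "\<epsilon> \<le> dist x y"
      "\<And>r. r = x \<or> r = y \<Longrightarrow> norm r \<le> M \<and> (\<forall>k\<in>{..<n}. dist (r * s k) (s k) < 1 / real (Suc n) \<and>
        dist (s k * r) (s k) < 1 / real (Suc n))"
      by blast
    \<comment> \<open>Two candidates at distance \<epsilon> cannot both be close to the previous
      member.\<close>
    have "\<epsilon> / 2 \<le> dist x (s (n - 1)) \<or> \<epsilon> / 2 \<le> dist y (s (n - 1))"
      using xy(1) dist_triangle2[of x y "s (n - 1)"] by linarith
    then show "\<exists>r. P s n r"
      using xy(2) unfolding P_def by blast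
  qed
  then obtain e where e: "\<And>n. P e n (e n)"
    by blast
  have eM: "norm (e n) \<le> M" for n
    using e[of n] by (simp add: P_def)
  have far: "\<epsilon> / 2 \<le> dist (e (Suc n)) (e n)" for n
    using e[of "Suc n"] by (simp add: P_def)
  have close: "dist (e m * e k) (e k) < 1 / real (Suc m)" "dist (e k * e m) (e k) < 1 / real (Suc m)"
    if "k < m" for k m
    using e[of m] that by (auto simp: P_def)
  have ee: "(\<lambda>m. e m * e k) \<longlonglongrightarrow> e k" "(\<lambda>m. e k * e m) \<longlonglongrightarrow> e k" for k
  proof -
    have ev: "\<forall>\<^sub>F m in sequentially. k < m"
      by (rule eventually_gt_at_top)
    have lim: "(\<lambda>m. 1 / real (Suc m)) \<longlonglongrightarrow> 0"
      by (rule LIMSEQ_Suc[OF lim_1_over_n])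
    show "(\<lambda>m. e m * e k) \<longlonglongrightarrow> e k" "(\<lambda>m. e k * e m) \<longlonglongrightarrow> e k"
      by (rule metric_tendsto_imp_tendsto[OF lim], rule eventually_mono[OF ev],
          use close in \<open>auto simp: less_imp_le\<close>)+
  qed
  have cont: "(h \<longlongrightarrow> l) N \<Longrightarrow> ((\<lambda>i. f (h i)) \<longlongrightarrow> f l) N" if "f \<in> top_dual scl" for f h l N
    using bounded_linear.tendsto[OF top_dual_bounded_linear[OF that]] by blast
  \<comment> \<open>Cohen's theorem puts all \<open>e n\<close> into \<open>b A\<close>, so a left
    unit for \<open>b\<close> is a left unit for every \<open>e n\<close>.\<close>
  obtain b where b: "\<And>n. \<exists>z. b * z = e n"
    using Cohen_factorization_sequence[OF E M Ea bounded_bilinear_mult mult.assoc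
        subspace_UNIV complete_UNIV, of e] Ea by auto
  have "\<exists>x. x * b = b"
  proof -
    \<comment> \<open>The cluster point of the approximate identity becomes the element
      \<open>x\<close> after right multiplication by \<open>b\<close>, while \<open>t * b\<close>
      tends to \<open>b\<close> in norm.\<close>
    obtain U F where U: "U \<le> E" "U \<noteq> bot" "F \<in> top_bidual scl"
        "\<And>f. f \<in> top_dual scl \<Longrightarrow> ((\<lambda>i. f i) \<longlongrightarrow> F f) U"
      using bidual_limit_exists[OF E M] by metis
    obtain x where x: "\<And>f. f \<in> top_dual scl \<Longrightarrow> F (\<lambda>t. f (t * b)) = f (x * b)"
      using Lww_property_representable[OF bil Lww U(3)] by blast
    have "f (x * b) = f b" if f: "f \<in> top_dual scl" for f
    proof (rule tendsto_unique[OF U(2)])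
      show "((\<lambda>t. f (t * b)) \<longlongrightarrow> f (x * b)) U"
        using U(4)[OF dual_comp_left[OF f, of b]] x[OF f] by simp
      show "((\<lambda>t. f (t * b)) \<longlongrightarrow> f b) U"
        by (rule cont[OF f tendsto_mono[OF U(1) Ea]])
    qed
    then show ?thesis
      using X.dual_separates_points by blast
  qed
  then obtain x where "x * b = b" ..
  then have x: "x * e n = e n" for n
    using b[of n] by (metis mult.assoc)
  obtain U F where U: "U \<le> sequentially" "U \<noteq> bot" "F \<in> top_bidual scl"
      "\<And>f. f \<in> top_dual scl \<Longrightarrow> ((\<lambda>n. f (e n)) \<longlongrightarrow> F f) U"
    using bidual_limit_exists[of sequentially e M scl] eM by auto
  \<comment> \<open>Weak compactness of right multiplication by \<open>x\<close>: the products
    \<open>e n * x\<close> converge weakly, along \<open>U\<close>, to an element of the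
    algebra.\<close>
  obtain y where y: "\<And>f. f \<in> top_dual scl \<Longrightarrow> F (\<lambda>t. f (t * x)) = f (y * x)"
    using Lww_property_representable[OF bil Lww U(3)] by blast
  define p where "p = y * x"
  have p: "((\<lambda>n. f (e n * x)) \<longlongrightarrow> f p) U" if "f \<in> top_dual scl" for f
    using U(4)[OF dual_comp_left[OF that, of x]] y[OF that] by (simp add: p_def)
  have pe: "p * e m = e m" for m
  proof (rule X.dual_separates_points)
    fix f
    assume f: "f \<in> top_dual scl"
    have "((\<lambda>n. f (e n * e m)) \<longlongrightarrow> f (p * e m)) U"
      using p[OF dual_comp_left[OF f, of "e m"]] by (simp add: mult.assoc x)
    moreover have "((\<lambda>n. f (e n * e m)) \<longlongrightarrow> f (e m)) U"
      by (rule cont[OF f tendsto_mono[OF U(1) ee(1)]])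
    ultimately show "f (p * e m) = f (e m)"
      by (rule tendsto_unique[OF U(2)])
  qed
  \<comment> \<open>The subspace on which the sequence is a right approximate identity. It contains
    every \<open>e n\<close>, so the weak limit \<open>p\<close> lies in the norm closure of
    \<open>W x\<close>.\<close>
  define W where "W = {d. (\<lambda>m. d * e m) \<longlonglongrightarrow> d}"
  have W_add: "d + d' \<in> W" if "d \<in> W" "d' \<in> W" for d d'
    using that tendsto_add[of "\<lambda>m. d * e m" d sequentially "\<lambda>m. d' * e m" d']
    by (simp add: W_def distrib_right)
  have W_scl: "scl c d \<in> W" if "d \<in> W" for c d
  proof -
    have "(\<lambda>m. norm c * norm (d * e m - d)) \<longlonglongrightarrow> norm c * 0"
      using that by (intro tendsto_mult_left tendsto_norm_zero) (simp add: W_def LIM_zero)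
    then have "(\<lambda>m. norm (scl c d * e m - scl c d)) \<longlonglongrightarrow> 0"
      by (simp add: scale_left X.norm_scale flip: X.scale_right_diff_distrib)
    then show ?thesis
      by (simp add: W_def tendsto_norm_zero_iff LIM_zero_iff)
  qed
  define N where "N = (\<lambda>d. d * x) ` W"
  obtain f where f: "f \<in> top_dual scl" "\<And>d. d \<in> W \<Longrightarrow> f (d * x) = 0"
      "infdist p N \<le> 2 * norm (f p)"
  proof -
    have "0 \<in> N"
      unfolding N_def by (rule image_eqI[of _ _ 0]) (auto simp: W_def)
    moreover have "u + v \<in> N" if "u \<in> N" "v \<in> N" for u v
      using that W_add by (auto simp: N_def distrib_right[symmetric])
    moreover have "scl c u \<in> N" if "u \<in> N" for c u
      using that W_scl by (auto simp: N_def scale_left[symmetric])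
    ultimately show ?thesis
      using X.dual_separates_subspace[of N p] that by (auto simp: N_def)
  qed
  have "f (e n * x) = 0" for n
    using f(2)[of "e n"] ee(2) by (simp add: W_def)
  then have "f p = 0"
    using p[OF f(1)] U(2) by (simp add: tendsto_const_iff)
  then have inf0: "infdist p N = 0"
    using f(3) infdist_nonneg[of p N] by simp
  have "M \<ge> 0"
    using eM norm_ge_zero order_trans by blast
  define \<eta> where "\<eta> = \<epsilon> / (8 * (M + 1))"
  have \<eta>: "\<eta> > 0" "\<eta> * M \<le> \<epsilon> / 8"
    using \<epsilon>(1) \<open>M \<ge> 0\<close> by (auto simp: \<eta>_def field_simps)
  have "N \<noteq> {}"
    by (auto simp: N_def W_def intro: exI[of _ 0])
  then obtain d where d: "d \<in> W" "dist p (d * x) < \<eta>"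
    using exists_dist_less_infdist[of N \<eta> p] \<eta>(1) inf0 by (auto simp: N_def)
  \<comment> \<open>Approximating \<open>p\<close> by \<open>d * x\<close> and multiplying by
    \<open>e m\<close> gives an estimate uniform in \<open>m\<close>. Since \<open>d * e m\<close>
    tends to \<open>d\<close>, consecutive members come too close.\<close>
  have near: "dist (e m) (d * e m) \<le> \<epsilon> / 8" for m
  proof -
    have "d * e m - e m = (d * x - p) * e m"
      by (simp add: left_diff_distrib pe mult.assoc x)
    then have "norm (d * e m - e m) \<le> norm (d * x - p) * norm (e m)"
      by (simp add: norm_mult_ineq)
    also have "\<dots> \<le> \<eta> * M"
      using d(2) eM \<eta>(1) by (intro mult_mono) (auto simp: dist_norm norm_minus_commute)
    finally show ?thesis
      using \<eta>(2) by (simp add: dist_norm norm_minus_commute)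
  qed
  have "\<forall>\<^sub>F m in sequentially. dist (d * e m) d < \<epsilon> / 8"
    using d(1) \<epsilon>(1) by (intro tendstoD) (auto simp: W_def)
  then obtain m where "dist (d * e m) d < \<epsilon> / 8" "dist (d * e (Suc m)) d < \<epsilon> / 8"
    by (meson eventually_sequentially le_SucI order_refl)
  then have "dist (e m) d < \<epsilon> / 4" "dist (e (Suc m)) d < \<epsilon> / 4"
    using near[of m] near[of "Suc m"] dist_triangle[of "e m" d "d * e m"]
      dist_triangle[of "e (Suc m)" d "d * e (Suc m)"] by linarith+
  then show False
    using far[of m] dist_triangle2[of "e (Suc m)" "e m" d] by simp
qed

text \<open>In a complete algebra the Cauchy approximate identity has a norm limit, which is a right
  unit.\<close>

corollary Lww_imp_unital:
  fixes scl :: "'k::{real_normed_field,heine_borel} \<Rightarrow> 'a::{real_normed_algebra,banach} \<Rightarrow> 'a"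
  assumes alg: "banach_algebra_over scl" and bai: "bounded_approximate_identity (E :: 'a filter)"
    and Lww: "Lww_property scl ((*) :: 'a \<Rightarrow> 'a \<Rightarrow> 'a)"
  shows "\<exists>u::'a. \<forall>a. a * u = a"
proof -
  have E: "E \<noteq> bot" "\<And>a. ((\<lambda>e. a * e) \<longlongrightarrow> a) E"
    using bai by (auto simp: bounded_approximate_identity_def)
  have "complete (UNIV :: 'a set)"
    by (rule complete_UNIV)
  then have "E \<noteq> bot \<Longrightarrow> cauchy_filter E \<Longrightarrow> \<exists>u\<in>UNIV. E \<le> nhds u"
    unfolding complete_uniform by auto
  then obtain u where "E \<le> nhds u"
    using E(1) Lww_approximate_identity_cauchy[OF assms] by blast
  then have "((\<lambda>e. e) \<longlongrightarrow> u) E"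
    by (simp add: filterlim_def)
  then have "a * u = a" for a
    by (intro tendsto_unique[OF E(1) _ E(2)] tendsto_mult_left)
  then show ?thesis
    by blast
qed

text \<open>Viewing the dual inside the normed type of bounded linear maps prepares it for Cohen's
  theorem. Pointwise limits stay in the dual and are approached uniformly on bounded sets.\<close>

lemma complete_blinfun_top_dual:
  fixes scl :: "'k::{real_normed_field,complete_space} \<Rightarrow> 'v::real_normed_vector \<Rightarrow> 'v"
  assumes scl: "normed_space_over scl"
  shows "complete {F. blinfun_apply F \<in> top_dual scl}"
  unfolding complete_def
proof (intro allI impI, elim conjE)
  fix F :: "nat \<Rightarrow> 'v \<Rightarrow>\<^sub>L 'k"
  assume FS: "\<forall>n. F n \<in> {F. blinfun_apply F \<in> top_dual scl}" and C: "Cauchy F"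
  have diff: "norm (F m x - F n x) \<le> norm (F m - F n) * norm x" for m n x
    using norm_blinfun[of "F m - F n" x] by (simp add: blinfun.diff_left)
  have "Cauchy (\<lambda>n. F n x)" for x
    by (rule bounded_linear.Cauchy[OF blinfun.bounded_linear_left C])
  then have "convergent (\<lambda>n. F n x)" for x
    by (rule Cauchy_convergent)
  then obtain l where l: "\<And>x. (\<lambda>n. F n x) \<longlonglongrightarrow> l x"
    unfolding convergent_def by metis
  obtain K where K: "\<And>n. norm (F n) \<le> K"
    using cauchy_imp_bounded[OF C] by (auto simp: bounded_iff)
  have "norm (F n x) \<le> K * norm x" for n x
    using norm_blinfun[of "F n" x] K[of n] by (meson mult_right_mono norm_ge_zero order_trans)
  then have l_dual: "l \<in> top_dual scl"
    using FS by (intro pointwise_limit_in_top_dual[where f = "\<lambda>n. blinfun_apply (F n)",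
          OF scl trivial_limit_sequentially _ _ l]) auto
  then have l_apply: "blinfun_apply (Blinfun l) = l"
    by (rule bounded_linear_Blinfun_apply[OF top_dual_bounded_linear])
  have "F \<longlonglongrightarrow> Blinfun l"
  proof (rule metric_LIMSEQ_I)
    fix r :: real
    assume "r > 0"
    then obtain N where N: "\<And>m n. m \<ge> N \<Longrightarrow> n \<ge> N \<Longrightarrow> dist (F m) (F n) < r / 2"
      using metric_CauchyD[OF C, of "r / 2"] by auto
    have "norm (F n - Blinfun l) \<le> r / 2" if "n \<ge> N" for n
    proof (rule norm_blinfun_bound)
      fix x
      have "norm (F n x - l x) \<le> r / 2 * norm x"
      proof (rule tendsto_upperbound[OF tendsto_norm[OF tendsto_diff[OF tendsto_const l]]])
        show "\<forall>\<^sub>F m in sequentially. norm (F n x - F m x) \<le> r / 2 * norm x"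
          using eventually_ge_at_top[of N]
        proof eventually_elim
          case (elim m)
          then show ?case
            using diff[of n x m] N[OF that, of m]
            by (smt (verit) dist_norm mult_right_mono norm_ge_zero)
        qed
      qed simp
      then show "norm (blinfun_apply (F n - Blinfun l) x) \<le> r / 2 * norm x"
        by (simp add: blinfun.diff_left l_apply)
    qed (use \<open>r > 0\<close> in simp)
    then show "\<exists>N. \<forall>n\<ge>N. dist (F n) (Blinfun l) < r"
      using \<open>r > 0\<close> by (intro exI[of _ N]) (force simp: dist_norm)
  qed
  then show "\<exists>l\<in>{F. blinfun_apply F \<in> top_dual scl}. F \<longlonglongrightarrow> l"
    using l_dual l_apply by (intro bexI[of _ "Blinfun l"]) auto
qed

section \<open>Topological centres\<close>

text \<open>Cohen's theorem writes all \<open>f n\<close> as \<open>a w\<close> with the same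
  \<open>a\<close> and varying \<open>w\<close>, and on functionals of this form \<open>F\<close> is
  evaluation at one \<open>b a\<close>.\<close>

lemma bidual_agrees_on_sequence:
  fixes scaleA :: "'k::{real_normed_field,heine_borel} \<Rightarrow> 'a::{real_normed_algebra,banach} \<Rightarrow> 'a"
    and scaleB :: "'k \<Rightarrow> 'b::banach \<Rightarrow> 'b"
  assumes E: "bounded_approximate_identity (E :: 'a filter)"
    and ract: "bounded_bilinear_over scaleB scaleA scaleB ract"
    and ract_mult: "\<And>b a a'. ract b (a * a') = ract (ract b a) a'"
    and factors: "dual_factors_right scaleB ract" and Lww: "Lww_property scaleB ract"
    and F: "F \<in> top_bidual scaleB" and f: "\<And>n::nat. f n \<in> top_dual scaleB"
  shows "\<exists>b. \<forall>n. F (f n) = f n b"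
proof -
  interpret bounded_bilinear_over scaleB scaleA scaleB ract
    by (rule ract)
  define S where "S = {g :: 'b \<Rightarrow>\<^sub>L 'k. blinfun_apply g \<in> top_dual scaleB}"
  define act where "act a g = Blinfun (\<lambda>b. blinfun_apply g (ract b a))" for a and g :: "'b \<Rightarrow>\<^sub>L 'k"
  have act_apply: "blinfun_apply (act a g) b = blinfun_apply g (ract b a)" for a g b
    unfolding act_def
    by (subst bounded_linear_Blinfun_apply)
      (auto intro: bounded_linear_compose[OF blinfun.bounded_linear_right bounded_linear_left])
  obtain K where K: "K \<ge> 0" "\<And>b a. norm (ract b a) \<le> norm b * norm a * K"
    using nonneg_bounded by blast
  have act: "bounded_bilinear act"
  proof
    fix a a' g g' r
    show "act (a + a') g = act a g + act a' g" "act a (g + g') = act a g + act a g'"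
      "act (r *\<^sub>R a) g = r *\<^sub>R act a g" "act a (r *\<^sub>R g) = r *\<^sub>R act a g"
      by (auto intro!: blinfun_eqI simp: act_apply add_right scaleR_right blinfun.add_right
          blinfun.add_left blinfun.scaleR_right blinfun.scaleR_left)
  next
    have "norm (act a g) \<le> norm a * norm g * K" for a g
    proof (rule norm_blinfun_bound)
      show "norm (blinfun_apply (act a g) b) \<le> norm a * norm g * K * norm b" for b
        using norm_blinfun[of g "ract b a"] mult_left_mono[OF K(2)[of b a] norm_ge_zero[of g]]
        by (simp add: act_apply ac_simps)
    qed (use K in simp)
    then show "\<exists>K. \<forall>a g. norm (act a g) \<le> norm a * norm g * K"
      by blast
  qed
  have act_mult: "act (a * a') g = act a (act a' g)" for a a' g
    by (rule blinfun_eqI) (simp add: act_apply ract_mult)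
  have act_S: "act a g \<in> S" if "g \<in> S" for a g
    using dual_comp_left[of "blinfun_apply g" a] that by (simp add: S_def act_apply[abs_def])
  have S_sub: "subspace S"
  proof (rule subspaceI)
    show "0 \<in> S"
      by (simp add: S_def zero_blinfun.rep_eq top_dual_zero)
    show "g + h \<in> S" if "g \<in> S" "h \<in> S" for g h
      using that top_dual_add[of g scaleB h] by (simp add: S_def plus_blinfun.rep_eq)
    show "r *\<^sub>R g \<in> S" if "g \<in> S" for r g
      using that top_dual_cmult[of g scaleB "of_real r"]
      by (simp add: S_def scaleR_blinfun.rep_eq scaleR_conv_of_real)
  qed
  have E': "E \<noteq> bot" "\<exists>M. \<forall>\<^sub>F e in E. norm e \<le> M" "\<And>a. ((\<lambda>e. e * a) \<longlongrightarrow> a) E"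
    using E by (auto simp: bounded_approximate_identity_def)
  \<comment> \<open>By factorization \<open>g = a h\<close>, so \<open>e g = (e a) h\<close> tends
    to \<open>a h\<close> in norm.\<close>
  have act_E: "((\<lambda>e. act e g) \<longlongrightarrow> g) E" if "g \<in> S" for g
  proof -
    obtain a h where h: "h \<in> top_dual scaleB" "blinfun_apply g = dual_lact ract a h"
      using factors \<open>g \<in> S\<close> unfolding dual_factors_right_def S_def by blast
    then have g: "g = act a (Blinfun h)"
      by (intro blinfun_eqI)
        (simp add: act_apply bounded_linear_Blinfun_apply top_dual_bounded_linear dual_lact_def)
    show ?thesis
      unfolding g act_mult[symmetric]
      by (intro bounded_bilinear.tendsto[OF act] E'(3) tendsto_const)
  qed
  obtain M where M: "\<forall>\<^sub>F e in E. norm e \<le> M"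
    using E'(2) by blast
  have f': "blinfun_apply (Blinfun (f n)) = f n" for n
    by (rule bounded_linear_Blinfun_apply[OF top_dual_bounded_linear[OF f]])
  obtain a where a: "\<And>n. \<exists>w\<in>S. act a w = Blinfun (f n)"
    using Cohen_factorization_sequence[OF E'(1) M E'(3) act act_mult S_sub
        complete_blinfun_top_dual[OF X.normed_space_over_axioms, folded S_def] act_S act_E,
        of "\<lambda>n. Blinfun (f n)"] f f' by (auto simp: S_def)
  obtain b where b: "\<And>g. g \<in> top_dual scaleB \<Longrightarrow> F (\<lambda>x. g (ract x a)) = g (ract b a)"
    using Lww_property_representable[OF ract Lww F] by blast
  have "F (f n) = f n b" for n
  proof -
    obtain w where w: "w \<in> S" "act a w = Blinfun (f n)"
      using a by blast
    then have "f n = (\<lambda>x. w (ract x a))"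
      using f'[of n] by (metis act_apply ext)
    then show ?thesis
      using b[of w] w(1) by (simp add: S_def)
  qed
  then show ?thesis
    by blast
qed

context banach_bimodule_over
begin

text \<open>With \<open>f = h a\<close>, the functional under \<open>F\<close> is
  \<open>t \<mapsto> g (a t)\<close> for \<open>g s = G (h (s b))\<close> as a function of
  \<open>b\<close>; there \<open>F\<close> is evaluation at \<open>a x\<close>.\<close>

lemma centre_lact_if_factors_left:
  assumes factors: "dual_factors_left scaleB lact"
    and Rww: "Rww_property scaleA ((*) :: 'a \<Rightarrow> 'a \<Rightarrow> 'a)" and F: "F \<in> top_bidual scaleA"
  shows "F \<in> topological_centre scaleA scaleB scaleB lact"
proof (rule left.topological_centreI[OF F])
  fix f
  assume "f \<in> top_dual scaleB"
  then obtain h a where h: "h \<in> top_dual scaleB" and f: "f = (\<lambda>b. h (lact a b))"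
    using factors unfolding dual_factors_left_def dual_ract_def by blast
  obtain x where x: "\<And>g. g \<in> top_dual scaleA \<Longrightarrow> F (\<lambda>t. g (a * t)) = g (a * x)"
    using Rww_property_representable[OF alg.bounded_bilinear_over_axioms Rww F] by blast
  have "F (\<lambda>t. G (\<lambda>b. f (lact t b))) = G (\<lambda>b. h (lact (a * x) b))"
    if G: "G \<in> top_bidual scaleB" for G
    using x[OF bounded_form_over.bidual_slice_in_top_dual[OF left.dual_comp_form[OF h] G]]
    by (simp add: f lact_mult)
  then show "\<exists>g\<in>top_dual scaleB. \<forall>G\<in>top_bidual scaleB. F (\<lambda>t. G (\<lambda>b. f (lact t b))) = G g"
    using left.dual_comp_right[OF h] by blast
qed

text \<open>The same argument, with the bimodule law moving \<open>a\<close> past the right action: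
  \<open>a (b t) = (a b) t\<close>.\<close>

lemma centre_ract_if_factors_left:
  assumes factors: "dual_factors_left scaleB lact"
    and Rww: "Rww_property scaleB lact" and F: "F \<in> top_bidual scaleB"
  shows "F \<in> topological_centre scaleB scaleA scaleB ract"
proof (rule right.topological_centreI[OF F])
  fix f
  assume "f \<in> top_dual scaleB"
  then obtain h a where h: "h \<in> top_dual scaleB" and f: "f = (\<lambda>b. h (lact a b))"
    using factors unfolding dual_factors_left_def dual_ract_def by blast
  obtain y where y: "\<And>g. g \<in> top_dual scaleB \<Longrightarrow> F (\<lambda>b. g (lact a b)) = g (lact a y)"
    using Rww_property_representable[OF left.bounded_bilinear_over_axioms Rww F] by blast
  have "F (\<lambda>b. G (\<lambda>t. f (ract b t))) = G (\<lambda>t. h (ract (lact a y) t))"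
    if G: "G \<in> top_bidual scaleA" for G
    using y[OF bounded_form_over.bidual_slice_in_top_dual[OF right.dual_comp_form[OF h] G]]
    by (simp add: f lact_ract)
  then show "\<exists>g\<in>top_dual scaleA. \<forall>G\<in>top_bidual scaleA. F (\<lambda>b. G (\<lambda>t. f (ract b t))) = G g"
    using right.dual_comp_right[OF h] by blast
qed

end

text \<open>Right multiplication by the right unit \<open>u\<close> is the identity, so the property
  at \<open>u\<close> makes \<open>F\<close> an evaluation on the whole dual.\<close>

lemma centre_lact_if_Lww:
  fixes scaleA :: "'k::{real_normed_field,heine_borel} \<Rightarrow> 'a::{real_normed_algebra,banach} \<Rightarrow> 'a"
  assumes bimodule: "banach_bimodule_over scaleA scaleB lact ract"
    and E: "bounded_approximate_identity (E :: 'a filter)"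
    and Lww: "Lww_property scaleA ((*) :: 'a \<Rightarrow> 'a \<Rightarrow> 'a)" and F: "F \<in> top_bidual scaleA"
  shows "F \<in> topological_centre scaleA scaleB scaleB lact"
proof -
  interpret banach_bimodule_over scaleA scaleB lact ract
    by (rule bimodule)
  obtain u where u: "\<And>a::'a. a * u = a"
    using Lww_imp_unital[OF alg.banach_algebra_over_axioms E Lww] by blast
  obtain x where x: "\<And>g. g \<in> top_dual scaleA \<Longrightarrow> F (\<lambda>t. g (t * u)) = g (x * u)"
    using Lww_property_representable[OF alg.bounded_bilinear_over_axioms Lww F] by blast
  show ?thesis
  proof (rule left.topological_centreI[OF F])
    fix f
    assume f: "f \<in> top_dual scaleB"
    have "F (\<lambda>t. G (\<lambda>b. f (lact t b))) = G (\<lambda>b. f (lact x b))" if G: "G \<in> top_bidual scaleB" for G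
      using x[OF bounded_form_over.bidual_slice_in_top_dual[OF left.dual_comp_form[OF f] G]]
      by (simp add: u)
    then show "\<exists>g\<in>top_dual scaleB. \<forall>G\<in>top_bidual scaleB. F (\<lambda>t. G (\<lambda>b. f (lact t b))) = G g"
      using left.dual_comp_right[OF f] by blast
  qed
qed

text \<open>Interchanging \<open>F\<close> and \<open>G\<close> by the double limit theorem exhibits
  the map as evaluation of \<open>G\<close> at the functional
  \<open>t \<mapsto> F (f (b t))\<close>, with \<open>F\<close> acting in \<open>b\<close>.\<close>

lemma centre_ract_if_factors_right:
  fixes scaleA :: "'k::{real_normed_field,heine_borel} \<Rightarrow> 'a::{real_normed_algebra,banach} \<Rightarrow> 'a"
  assumes bimodule: "banach_bimodule_over scaleA scaleB lact ract"
    and E: "bounded_approximate_identity (E :: 'a filter)"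
    and factors: "dual_factors_right scaleB ract" and Lww: "Lww_property scaleB ract"
    and F: "F \<in> top_bidual scaleB"
  shows "F \<in> topological_centre scaleB scaleA scaleB ract"
proof -
  interpret banach_bimodule_over scaleA scaleB lact ract
    by (rule bimodule)
  note agree = bidual_agrees_on_sequence[OF E right.bounded_bilinear_over_axioms ract_mult factors Lww]
  show ?thesis
  proof (rule right.topological_centreI[OF F])
    fix f
    assume f: "f \<in> top_dual scaleB"
    note form = bounded_form_over.flip_form[OF right.dual_comp_form[OF f]]
    have "F (\<lambda>b. G (\<lambda>t. f (ract b t))) = G (\<lambda>t. F (\<lambda>b. f (ract b t)))" if G: "G \<in> top_bidual scaleA" for G
      using bidual_extensions_agree[OF form G F agree] by simp
    then show "\<exists>g\<in>top_dual scaleA. \<forall>G\<in>top_bidual scaleA. F (\<lambda>b. G (\<lambda>t. f (ract b t))) = G g"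
      using bounded_form_over.bidual_slice_in_top_dual[OF form F] by blast
  qed
qed

theorem mainTheorem7:
  fixes scaleA :: "'k::{real_normed_field,heine_borel} \<Rightarrow> 'a::{real_normed_algebra,banach} \<Rightarrow> 'a"
    and scaleB :: "'k \<Rightarrow> 'b::banach \<Rightarrow> 'b"
    and lact :: "'a \<Rightarrow> 'b \<Rightarrow> 'b"
    and ract :: "'b \<Rightarrow> 'a \<Rightarrow> 'b"
  assumes "banach_algebra_over scaleA"
    and "\<exists>E::'a filter. bounded_approximate_identity E"
    and "banach_bimodule_over scaleA scaleB lact ract"
  shows
    "((dual_factors_left scaleB lact \<and> Rww_property scaleA ((*) :: 'a \<Rightarrow> 'a \<Rightarrow> 'a)) \<or>
      (dual_factors_right scaleB ract \<and> Lww_property scaleA ((*) :: 'a \<Rightarrow> 'a \<Rightarrow> 'a))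
        \<longrightarrow> topological_centre scaleA scaleB scaleB lact = top_bidual scaleA) \<and>
     ((dual_factors_left scaleB lact \<and> Rww_property scaleB lact) \<or>
      (dual_factors_right scaleB ract \<and> Lww_property scaleB ract)
        \<longrightarrow> topological_centre scaleB scaleA scaleB ract = top_bidual scaleB)"
proof -
  interpret banach_bimodule_over scaleA scaleB lact ract
    by fact
  obtain E :: "'a filter" where E: "bounded_approximate_identity E"
    using assms(2) by blast
  have "topological_centre scaleA scaleB scaleB lact \<subseteq> top_bidual scaleA"
    "topological_centre scaleB scaleA scaleB ract \<subseteq> top_bidual scaleB"
    by (auto simp: topological_centre_def)
  then show ?thesis
    using centre_lact_if_factors_left centre_ract_if_factors_left
      centre_lact_if_Lww[OF assms(3) E] centre_ract_if_factors_right[OF assms(3) E]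
    by blast
qed

end
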